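(* Let $\mathcal{G}$ be a groupoid and let $R$ be a $\mathcal{G}$-graded ring which is object unital, with $1_{R_e}\neq0$ for all $e\in\mathcal{G}_0$. Then $R$ is (isomorphic as a $\mathcal{G}$-graded ring to) an object skew groupoid ring if and only if the degree map $\deg:U^{\mathrm{gr}}(R)\to\mathcal{G}$ is surjective and splits as a homomorphism of groupoids.
   Context: Rings are associative but not necessarily unital. A groupoid $\mathcal{G}$ is a small category in which every morphism is an isomorphism, identified with its set of morphisms; $d(\sigma)=\sigma^{-1}\sigma$, $r(\sigma)=\sigma\sigma^{-1}$; $\mathcal{G}_0$ is the set of identity elements; $\sigma\tau$ is defined iff $d(\sigma)=r(\tau)$; $\mathcal{G}_2$ is the set of composable pairs. A map $f$ of groupoids is a groupoid homomorphism if whenever $gh$ is defined, $f(g)f(h)$ is defined and $f(gh)=f(g)f(h)$. A ring $R$ is $\mathcal{G}$-graded if $R=\bigoplus_{\sigma\in\mathcal{G}}R_\sigma$ for additive subgroups $R_\sigma$ with $R_\sigma R_\tau\subseteq R_{\sigma\tau}$ if $(\sigma,\tau)\in\mathcal{G}_2$ and $R_\sigma R_\tau=\{0\}$ otherwise. It is object unital if each ring $R_e$, $e\in\mathcal{G}_0$, is unital and $1_{R_{r(\sigma)}}x=x1_{R_{d(\sigma)}}=x$ for all $\sigma\in\mathcal{G}$, $x\in R_\sigma$. An element $x\in R_\sigma$ is object invertible if there is a (necessarily unique) $y\in R_{\sigma^{-1}}$, its object inverse, with $xy=1_{R_{r(\sigma)}}$ and $yx=1_{R_{d(\sigma)}}$.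 $U^{\mathrm{gr}}(R)$ is the set of all object invertible elements, a groupoid in which $x\cdot y$ is defined (and equal to the ring product $xy$) precisely when $d(\deg x)=r(\deg y)$, with inverse the object inverse; here $\deg x=\sigma$ for $0\ne x\in R_\sigma$, and $\deg:U^{\mathrm{gr}}(R)\to\mathcal{G}$ is a groupoid homomorphism. It splits if there is a groupoid homomorphism $\varphi:\mathcal{G}\to U^{\mathrm{gr}}(R)$ with $\deg\circ\varphi=\mathrm{id}_{\mathcal{G}}$. An object skew groupoid ring $A\rtimes^\alpha\mathcal{G}$ is given by a family $A=(A_e)_{e\in\mathcal{G}_0}$ of non-zero unital rings and unital ring isomorphisms $\alpha_\sigma:A_{d(\sigma)}\to A_{r(\sigma)}$, $\sigma\in\mathcal{G}$, with $\alpha_e=\mathrm{id}_{A_e}$ for $e\in\mathcal{G}_0$ and $\alpha_\sigma\circ\alpha_\tau=\alpha_{\sigma\tau}$ for $(\sigma,\tau)\in\mathcal{G}_2$ (i.e. an object crossed system with trivial cocycle): it consists of formal sums $\sum_\sigma a_\sigma u_\sigma$, $a_\sigma\in A_{r(\sigma)}$ almost all zero, with product the additive extension of $a_\sigma u_\sigma\cdot a'_\tau u_\tau=a_\sigma\alpha_\sigma(a'_\tau)u_{\sigma\tau}$ if $(\sigma,\tau)\in\mathcal{G}_2$ and $0$ otherwise, graded by $A_{r(\sigma)}u_\sigma$ in degree $\sigma$. *)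

theory Defs
  imports "HOL-Algebra.QuotRing"
begin

section \<open>Groupoids\<close>

text \<open>A small category in the one-sorted presentation: an object is identified with its
  identity morphism, so \<open>Dom\<close> and \<open>Cod\<close> return identity morphisms.
  Composition is only meaningful on \<open>composable\<close> pairs.\<close>

record 'g gpd =
  Mor :: "'g set"
  Dom :: "'g \<Rightarrow> 'g"
  Cod :: "'g \<Rightarrow> 'g"
  Cmp :: "'g \<Rightarrow> 'g \<Rightarrow> 'g"  (infixl \<open>\<bullet>\<index>\<close> 70)

definition objects :: "('g, 'm) gpd_scheme \<Rightarrow> 'g set" where
  "objects G = Dom G ` Mor G"

definition composable :: "('g, 'm) gpd_scheme \<Rightarrow> ('g \<times> 'g) set" where
  "composable G = {(s, t). s \<in> Mor G \<and> t \<in> Mor G \<and> Dom G s = Cod G t}"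

definition is_inverse :: "('g, 'm) gpd_scheme \<Rightarrow> 'g \<Rightarrow> 'g \<Rightarrow> bool" where
  "is_inverse G s t \<longleftrightarrow> t \<in> Mor G \<and> Dom G t = Cod G s \<and> Cod G t = Dom G s \<and>
     s \<bullet>\<^bsub>G\<^esub> t = Cod G s \<and> t \<bullet>\<^bsub>G\<^esub> s = Dom G s"

definition ginv :: "('g, 'm) gpd_scheme \<Rightarrow> 'g \<Rightarrow> 'g" where
  "ginv G s = (THE t. is_inverse G s t)"

locale groupoid =
  fixes G :: "('g, 'm) gpd_scheme" (structure)
  assumes Dom_closed: "s \<in> Mor G \<Longrightarrow> Dom G s \<in> Mor G"
    and Cod_closed: "s \<in> Mor G \<Longrightarrow> Cod G s \<in> Mor G"
    and Dom_Dom: "s \<in> Mor G \<Longrightarrow> Dom G (Dom G s) = Dom G s"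
    and Cod_Dom: "s \<in> Mor G \<Longrightarrow> Cod G (Dom G s) = Dom G s"
    and Dom_Cod: "s \<in> Mor G \<Longrightarrow> Dom G (Cod G s) = Cod G s"
    and Cod_Cod: "s \<in> Mor G \<Longrightarrow> Cod G (Cod G s) = Cod G s"
    and Cmp_closed: "(s, t) \<in> composable G \<Longrightarrow> s \<bullet> t \<in> Mor G"
    and Dom_Cmp: "(s, t) \<in> composable G \<Longrightarrow> Dom G (s \<bullet> t) = Dom G t"
    and Cod_Cmp: "(s, t) \<in> composable G \<Longrightarrow> Cod G (s \<bullet> t) = Cod G s"
    and Cmp_assoc: "(s, t) \<in> composable G \<Longrightarrow> (t, u) \<in> composable G \<Longrightarrow>
          (s \<bullet> t) \<bullet> u = s \<bullet> (t \<bullet> u)"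
    and Cmp_Dom: "s \<in> Mor G \<Longrightarrow> s \<bullet> Dom G s = s"
    and Cmp_Cod: "s \<in> Mor G \<Longrightarrow> Cod G s \<bullet> s = s"
    and inverse_exists: "s \<in> Mor G \<Longrightarrow> \<exists>t. is_inverse G s t"

definition groupoid_hom :: "('g, 'm) gpd_scheme \<Rightarrow> ('h, 'n) gpd_scheme \<Rightarrow> ('g \<Rightarrow> 'h) set" where
  "groupoid_hom G H = {f. f \<in> Mor G \<rightarrow> Mor H \<and>
     (\<forall>(s, t) \<in> composable G. (f s, f t) \<in> composable H \<and> f (s \<bullet>\<^bsub>G\<^esub> t) = f s \<bullet>\<^bsub>H\<^esub> f t)}"

definition splits :: "('h, 'n) gpd_scheme \<Rightarrow> ('g, 'm) gpd_scheme \<Rightarrow> ('h \<Rightarrow> 'g) \<Rightarrow> bool" where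
  "splits H G p \<longleftrightarrow> (\<exists>f \<in> groupoid_hom G H. \<forall>s \<in> Mor G. p (f s) = s)"


section \<open>Graded rings\<close>

text \<open>Rings need not be unital. We keep the record type of \<open>HOL-Algebra\<close>, but the
  field \<open>one\<close> carries no meaning for a \<open>rng\<close> and is never referred to.\<close>

locale rng = abelian_group R for R :: "('r, 'k) ring_scheme" (structure) +
  assumes rng_m_closed: "x \<in> carrier R \<Longrightarrow> y \<in> carrier R \<Longrightarrow> x \<otimes> y \<in> carrier R"
    and rng_m_assoc: "x \<in> carrier R \<Longrightarrow> y \<in> carrier R \<Longrightarrow> z \<in> carrier R \<Longrightarrow>
          (x \<otimes> y) \<otimes> z = x \<otimes> (y \<otimes> z)"
    and rng_l_distr: "x \<in> carrier R \<Longrightarrow> y \<in> carrier R \<Longrightarrow> z \<in> carrier R \<Longrightarrow>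
          (x \<oplus> y) \<otimes> z = x \<otimes> z \<oplus> y \<otimes> z"
    and rng_r_distr: "x \<in> carrier R \<Longrightarrow> y \<in> carrier R \<Longrightarrow> z \<in> carrier R \<Longrightarrow>
          z \<otimes> (x \<oplus> y) = z \<otimes> x \<oplus> z \<otimes> y"

text \<open>In \<open>direct_sum\<close> the sum is taken over the support only, because \<open>finsum\<close>
  over an infinite index set is \<open>\<zero>\<close> by convention.\<close>

locale graded_rng = groupoid G + rng R
  for G :: "('g, 'm) gpd_scheme" and R :: "('r, 'k) ring_scheme" (structure) +
  fixes Rg :: "'g \<Rightarrow> 'r set"
  assumes component: "s \<in> Mor G \<Longrightarrow> additive_subgroup (Rg s) R"
    and direct_sum: "x \<in> carrier R \<Longrightarrow>
          \<exists>!f. f \<in> (\<Pi>\<^sub>E s \<in> Mor G. Rg s) \<and> finite {s \<in> Mor G. f s \<noteq> \<zero>} \<and>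
               x = (\<Oplus>s \<in> {s \<in> Mor G. f s \<noteq> \<zero>}. f s)"
    and graded_mult: "(s, t) \<in> composable G \<Longrightarrow> x \<in> Rg s \<Longrightarrow> y \<in> Rg t \<Longrightarrow>
          x \<otimes> y \<in> Rg (s \<bullet>\<^bsub>G\<^esub> t)"
    and graded_mult_zero: "s \<in> Mor G \<Longrightarrow> t \<in> Mor G \<Longrightarrow> (s, t) \<notin> composable G \<Longrightarrow>
          x \<in> Rg s \<Longrightarrow> y \<in> Rg t \<Longrightarrow> x \<otimes> y = \<zero>"

definition is_unity_of :: "('r, 'k) ring_scheme \<Rightarrow> 'r set \<Rightarrow> 'r \<Rightarrow> bool" where
  "is_unity_of R S u \<longleftrightarrow> u \<in> S \<and> (\<forall>x \<in> S. u \<otimes>\<^bsub>R\<^esub> x = x \<and> x \<otimes>\<^bsub>R\<^esub> u = x)"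

definition unity_of :: "('r, 'k) ring_scheme \<Rightarrow> 'r set \<Rightarrow> 'r" where
  "unity_of R S = (THE u. is_unity_of R S u)"

locale object_unital_rng = graded_rng +
  assumes unital: "e \<in> objects G \<Longrightarrow> \<exists>u. is_unity_of R (Rg e) u"
    and unity_left: "s \<in> Mor G \<Longrightarrow> x \<in> Rg s \<Longrightarrow> unity_of R (Rg (Cod G s)) \<otimes> x = x"
    and unity_right: "s \<in> Mor G \<Longrightarrow> x \<in> Rg s \<Longrightarrow> x \<otimes> unity_of R (Rg (Dom G s)) = x"


section \<open>The groupoid of object invertible elements\<close>

definition object_invertible ::
  "('g, 'm) gpd_scheme \<Rightarrow> ('r, 'k) ring_scheme \<Rightarrow> ('g \<Rightarrow> 'r set) \<Rightarrow> 'g \<Rightarrow> 'r \<Rightarrow> bool" where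
  "object_invertible G R Rg s x \<longleftrightarrow> x \<in> Rg s \<and>
     (\<exists>y \<in> Rg (ginv G s). x \<otimes>\<^bsub>R\<^esub> y = unity_of R (Rg (Cod G s)) \<and>
                          y \<otimes>\<^bsub>R\<^esub> x = unity_of R (Rg (Dom G s)))"

text \<open>The degree; only meaningful for nonzero homogeneous elements.\<close>

definition gdeg :: "('g, 'm) gpd_scheme \<Rightarrow> ('g \<Rightarrow> 'r set) \<Rightarrow> 'r \<Rightarrow> 'g" where
  "gdeg G Rg x = (THE s. s \<in> Mor G \<and> x \<in> Rg s)"

text \<open>The identities of this groupoid are the elements \<open>unity_of R (Rg e)\<close>, so
  composability in the sense of \<open>composable\<close> amounts to
  \<open>Dom G (gdeg G Rg x) = Cod G (gdeg G Rg y)\<close>, and inverses are the object inverses;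
  see \<open>composable_unit_groupoid\<close> and \<open>groupoid_unit_groupoid\<close> below.\<close>

definition unit_groupoid ::
  "('g, 'm) gpd_scheme \<Rightarrow> ('r, 'k) ring_scheme \<Rightarrow> ('g \<Rightarrow> 'r set) \<Rightarrow> 'r gpd" where
  "unit_groupoid G R Rg =
     \<lparr>Mor = {x. \<exists>s \<in> Mor G. object_invertible G R Rg s x},
      Dom = (\<lambda>x. unity_of R (Rg (Dom G (gdeg G Rg x)))),
      Cod = (\<lambda>x. unity_of R (Rg (Cod G (gdeg G Rg x)))),
      Cmp = mult R\<rparr>"


section \<open>Object skew groupoid rings\<close>

text \<open>\<open>ring\<close> and \<open>ring_iso\<close> of \<open>HOL-Algebra\<close> are unital; the maps \<open>\<alpha> s\<close> are
  only constrained on the carriers.\<close>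

locale object_skew_system = groupoid G
  for G :: "('g, 'm) gpd_scheme" (structure) +
  fixes A :: "'g \<Rightarrow> ('a, 'k) ring_scheme"
    and \<alpha> :: "'g \<Rightarrow> 'a \<Rightarrow> 'a"
  assumes A_ring: "e \<in> objects G \<Longrightarrow> ring (A e)"
    and A_nonzero: "e \<in> objects G \<Longrightarrow> \<one>\<^bsub>A e\<^esub> \<noteq> \<zero>\<^bsub>A e\<^esub>"
    and \<alpha>_iso: "s \<in> Mor G \<Longrightarrow> \<alpha> s \<in> ring_iso (A (Dom G s)) (A (Cod G s))"
    and \<alpha>_id: "e \<in> objects G \<Longrightarrow> a \<in> carrier (A e) \<Longrightarrow> \<alpha> e a = a"
    and \<alpha>_comp: "(s, t) \<in> composable G \<Longrightarrow> a \<in> carrier (A (Dom G t)) \<Longrightarrow>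
          \<alpha> s (\<alpha> t a) = \<alpha> (s \<bullet> t) a"

definition skew_support :: "('g, 'm) gpd_scheme \<Rightarrow> ('g \<Rightarrow> ('a, 'k) ring_scheme) \<Rightarrow> ('g \<Rightarrow> 'a) \<Rightarrow> 'g set" where
  "skew_support G A f = {s \<in> Mor G. f s \<noteq> \<zero>\<^bsub>A (Cod G s)\<^esub>}"

text \<open>The formal sum of the \<open>a\<^sub>s u\<^sub>s\<close> is the coefficient function \<open>s \<mapsto> a\<^sub>s\<close>; the
  coefficient of a product at \<open>p\<close> collects the terms \<open>a\<^sub>s \<alpha>\<^sub>s(b\<^sub>t)\<close> with \<open>s t\<close> defined and
  equal to \<open>p\<close>. There is no unity in general, hence no value for \<open>one\<close>.\<close>

definition skew_ring ::
  "('g, 'm) gpd_scheme \<Rightarrow> ('g \<Rightarrow> ('a, 'k) ring_scheme) \<Rightarrow> ('g \<Rightarrow> 'a \<Rightarrow> 'a) \<Rightarrow> ('g \<Rightarrow> 'a) ring" where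
  "skew_ring G A \<alpha> =
     \<lparr>carrier = {f \<in> (\<Pi>\<^sub>E s \<in> Mor G. carrier (A (Cod G s))). finite (skew_support G A f)},
      mult = (\<lambda>f g. \<lambda>p \<in> Mor G.
        finsum (A (Cod G p)) (\<lambda>(s, t). f s \<otimes>\<^bsub>A (Cod G p)\<^esub> \<alpha> s (g t))
          {(s, t) \<in> composable G.
             s \<in> skew_support G A f \<and> t \<in> skew_support G A g \<and> s \<bullet>\<^bsub>G\<^esub> t = p}),
      one = undefined,
      zero = (\<lambda>s \<in> Mor G. \<zero>\<^bsub>A (Cod G s)\<^esub>),
      add = (\<lambda>f g. \<lambda>s \<in> Mor G. f s \<oplus>\<^bsub>A (Cod G s)\<^esub> g s)\<rparr>"

definition skew_component ::
  "('g, 'm) gpd_scheme \<Rightarrow> ('g \<Rightarrow> ('a, 'k) ring_scheme) \<Rightarrow> ('g \<Rightarrow> 'a \<Rightarrow> 'a) \<Rightarrow> 'g \<Rightarrow> ('g \<Rightarrow> 'a) set" where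
  "skew_component G A \<alpha> s = {f \<in> carrier (skew_ring G A \<alpha>). skew_support G A f \<subseteq> {s}}"

text \<open>\<open>ring_iso\<close> is not suitable here, as it refers to \<open>one\<close>.\<close>

definition graded_iso ::
  "('g, 'm) gpd_scheme \<Rightarrow> ('r, 'k) ring_scheme \<Rightarrow> ('g \<Rightarrow> 'r set) \<Rightarrow>
   ('s, 'l) ring_scheme \<Rightarrow> ('g \<Rightarrow> 's set) \<Rightarrow> ('r \<Rightarrow> 's) set" where
  "graded_iso G R Rg S Sg = {h. h \<in> iso (add_monoid R) (add_monoid S) \<and> h \<in> hom R S \<and>
     (\<forall>s \<in> Mor G. h ` Rg s = Sg s)}"

text \<open>The type argument is the type from which the coefficient rings \<open>A e\<close> take their elements.\<close>

definition is_object_skew_groupoid_ring ::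
  "'a itself \<Rightarrow> ('g, 'm) gpd_scheme \<Rightarrow> ('r, 'k) ring_scheme \<Rightarrow> ('g \<Rightarrow> 'r set) \<Rightarrow> bool" where
  "is_object_skew_groupoid_ring T G R Rg \<longleftrightarrow>
     (\<exists>(A :: 'g \<Rightarrow> 'a ring) \<alpha>. object_skew_system G A \<alpha> \<and>
        graded_iso G R Rg (skew_ring G A \<alpha>) (skew_component G A \<alpha>) \<noteq> {})"


section \<open>Products of monomials in a skew ring\<close>

context object_skew_system
begin

definition monomial :: "'g \<Rightarrow> 'a \<Rightarrow> 'g \<Rightarrow> 'a" where
  "monomial s a = (\<lambda>p \<in> Mor G. if p = s then a else \<zero>\<^bsub>A (Cod G p)\<^esub>)"

lemma skew_support_monomial:
  "s \<in> Mor G \<Longrightarrow> skew_support G A (monomial s a) = (if a = \<zero>\<^bsub>A (Cod G s)\<^esub> then {} else {s})"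
  by (auto simp: skew_support_def monomial_def)

lemma Cod_in_objects: "s \<in> Mor G \<Longrightarrow> Cod G s \<in> objects G"
  unfolding objects_def using Cod_closed Dom_Cod by (metis imageI)

lemma \<alpha>_ring_hom:
  assumes s: "s \<in> Mor G"
  shows "\<alpha> s \<in> ring_hom (A (Dom G s)) (A (Cod G s))"
  using \<alpha>_iso[OF s] by (simp add: ring_iso_def)

lemma monomial_mult:
  assumes s: "s \<in> Mor G" and t: "t \<in> Mor G"
    and a: "a \<in> carrier (A (Cod G s))" and b: "b \<in> carrier (A (Cod G t))"
  shows "monomial s a \<otimes>\<^bsub>skew_ring G A \<alpha>\<^esub> monomial t b =
    (if (s, t) \<in> composable G then monomial (s \<bullet> t) (a \<otimes>\<^bsub>A (Cod G s)\<^esub> \<alpha> s b)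
     else \<zero>\<^bsub>skew_ring G A \<alpha>\<^esub>)" (is "?l = ?r")
proof
  fix p
  have rc: "ring (A (Cod G q))" if "q \<in> Mor G" for q using A_ring Cod_in_objects that by blast
  let ?I = "{(s', t') \<in> composable G. s' \<in> skew_support G A (monomial s a) \<and>
      t' \<in> skew_support G A (monomial t b) \<and> s' \<bullet> t' = p}"
  let ?F = "\<lambda>(s', t'). monomial s a s' \<otimes>\<^bsub>A (Cod G p)\<^esub> \<alpha> s' (monomial t b t')"
  have l: "?l p = (if p \<in> Mor G then finsum (A (Cod G p)) ?F ?I else undefined)"
    by (simp add: skew_ring_def)
  have ms: "monomial s a s = a" "monomial t b t = b" using s t by (simp_all add: monomial_def)
  show "?l p = ?r p"
  proof (cases "p \<in> Mor G \<and> (s, t) \<in> composable G \<and> s \<bullet> t = p")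
    case False
    then have I: "?I = {}" if "p \<in> Mor G"
      using that skew_support_monomial[OF s] skew_support_monomial[OF t] by (auto split: if_splits)
    have "?l p = (if p \<in> Mor G then \<zero>\<^bsub>A (Cod G p)\<^esub> else undefined)"
    proof (cases "p \<in> Mor G")
      case p: True
      interpret P: ring "A (Cod G p)" using rc p .
      show ?thesis using l p I[OF p] by (simp only: P.finsum_empty if_True)
    qed (use l in simp)
    moreover have "?r p = (if p \<in> Mor G then \<zero>\<^bsub>A (Cod G p)\<^esub> else undefined)"
      using False by (auto simp: skew_ring_def monomial_def)
    ultimately show ?thesis by simp
  next
    case True
    interpret P: ring "A (Cod G p)" using rc True by blast
    have cp: "Cod G p = Cod G s" using True Cod_Cmp by blast
    have ds: "Dom G s = Cod G t" using True by (simp add: composable_def)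
    have ab: "\<alpha> s b \<in> carrier (A (Cod G p))"
      using ring_hom_closed[OF \<alpha>_ring_hom[OF s]] b ds cp by simp
    have r: "?r p = a \<otimes>\<^bsub>A (Cod G p)\<^esub> \<alpha> s b" using True cp by (simp add: monomial_def)
    show ?thesis
    proof (cases "a = \<zero>\<^bsub>A (Cod G s)\<^esub> \<or> b = \<zero>\<^bsub>A (Cod G t)\<^esub>")
      case z: True
      then have "?I = {}" using skew_support_monomial[OF s] skew_support_monomial[OF t] by auto
      then have "?l p = \<zero>\<^bsub>A (Cod G p)\<^esub>" using l True by (simp only: P.finsum_empty if_True)
      moreover have "\<alpha> s \<zero>\<^bsub>A (Cod G t)\<^esub> = \<zero>\<^bsub>A (Cod G p)\<^esub>"
        using ring_hom_zero[OF \<alpha>_ring_hom[OF s]] rc[OF s] rc[OF t] ds cp by simp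
      moreover have "a \<otimes>\<^bsub>A (Cod G p)\<^esub> \<alpha> s b = \<zero>\<^bsub>A (Cod G p)\<^esub>"
        using z calculation(2) ab a cp P.l_null P.r_null by metis
      ultimately show ?thesis using r by simp
    next
      case False
      then have "?I = {(s, t)}"
        using skew_support_monomial[OF s] skew_support_monomial[OF t] True by auto
      then have "?l p = finsum (A (Cod G p)) ?F {(s, t)}" using l True by (simp only: if_True)
      also have "\<dots> = a \<otimes>\<^bsub>A (Cod G p)\<^esub> \<alpha> s b"
      proof -
        have ac: "a \<in> carrier (A (Cod G p))" using a cp by simp
        have F: "?F (s, t) = a \<otimes>\<^bsub>A (Cod G p)\<^esub> \<alpha> s b" using ms by simp
        have m: "a \<otimes>\<^bsub>A (Cod G p)\<^esub> \<alpha> s b \<in> carrier (A (Cod G p))" using ac ab by simp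
        then have "finsum (A (Cod G p)) ?F {(s, t)} = ?F (s, t) \<oplus>\<^bsub>A (Cod G p)\<^esub> finsum (A (Cod G p)) ?F {}"
          using F by (intro P.finsum_insert) auto
        then show ?thesis using F m by (simp only: P.finsum_empty P.r_zero)
      qed
      finally show ?thesis using r by simp
    qed
  qed
qed

end


section \<open>The unit groupoid is a groupoid and the degree map a homomorphism\<close>

context groupoid
begin

lemma is_inverse_unique:
  assumes s: "s \<in> Mor G" and t: "is_inverse G s t" and u: "is_inverse G s u"
  shows "t = u"
proof -
  have "(t, s) \<in> composable G" "(s, u) \<in> composable G"
    using assms by (auto simp: composable_def is_inverse_def)
  then have "(t \<bullet> s) \<bullet> u = t \<bullet> (s \<bullet> u)" by (rule Cmp_assoc)
  then show ?thesis
    using assms Cmp_Dom[of t] Cmp_Cod[of u] by (auto simp: is_inverse_def)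
qed

lemma is_inverse_ginv:
  assumes "s \<in> Mor G" shows "is_inverse G s (ginv G s)"
  unfolding ginv_def
  using inverse_exists[OF assms] is_inverse_unique[OF assms] by (metis theI)

lemma ginv_ginv:
  assumes "s \<in> Mor G" shows "ginv G (ginv G s) = s"
proof -
  have i: "is_inverse G s (ginv G s)" by (rule is_inverse_ginv[OF assms])
  then have "is_inverse G (ginv G s) s" using assms by (auto simp: is_inverse_def)
  moreover have "ginv G s \<in> Mor G" using i by (simp add: is_inverse_def)
  ultimately show ?thesis using is_inverse_unique is_inverse_ginv by blast
qed

lemma ginv_simps:
  assumes "s \<in> Mor G"
  shows "ginv G s \<in> Mor G" "Dom G (ginv G s) = Cod G s" "Cod G (ginv G s) = Dom G s"
    "s \<bullet> ginv G s = Cod G s" "ginv G s \<bullet> s = Dom G s"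
  using is_inverse_ginv[OF assms] by (auto simp: is_inverse_def)

lemma objects_iff: "e \<in> objects G \<longleftrightarrow> e \<in> Mor G \<and> Dom G e = e"
  by (auto simp: objects_def Dom_closed Dom_Dom intro: rev_image_eqI)

lemma objects_simps:
  assumes "e \<in> objects G"
  shows "e \<in> Mor G" "Dom G e = e" "Cod G e = e"
  using assms by (auto simp: objects_def Dom_closed Dom_Dom Cod_Dom)

lemma Dom_objects: "s \<in> Mor G \<Longrightarrow> Dom G s \<in> objects G"
  by (simp add: objects_def)

lemma Cod_objects: "s \<in> Mor G \<Longrightarrow> Cod G s \<in> objects G"
  by (simp add: objects_iff Cod_closed Dom_Cod)

lemma ginv_object:
  assumes "e \<in> objects G" shows "ginv G e = e"
proof -
  have "is_inverse G e e"
    using objects_simps[OF assms] Cmp_Dom[of e] by (simp add: is_inverse_def)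
  then show ?thesis using is_inverse_unique is_inverse_ginv objects_simps(1)[OF assms] by blast
qed

lemma ginv_Cmp:
  assumes st: "(s, t) \<in> composable G"
  shows "ginv G (s \<bullet> t) = ginv G t \<bullet> ginv G s"
proof -
  have s: "s \<in> Mor G" and t: "t \<in> Mor G" and d: "Dom G s = Cod G t"
    using st by (auto simp: composable_def)
  note i = ginv_simps[OF s] ginv_simps[OF t]
  have c1: "(ginv G t, ginv G s) \<in> composable G" using i d by (simp add: composable_def)
  have c2: "(t, ginv G t) \<in> composable G" using i t by (simp add: composable_def)
  have c3: "(ginv G s, s) \<in> composable G" using i s by (simp add: composable_def)
  have c4: "(s, t \<bullet> (ginv G t \<bullet> ginv G s)) \<in> composable G"
    and c5: "(t, ginv G t \<bullet> ginv G s) \<in> composable G"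
    using c1 c2 s t i d Cmp_closed Cod_Cmp Dom_Cmp by (auto simp: composable_def)
  have "(s \<bullet> t) \<bullet> (ginv G t \<bullet> ginv G s) = s \<bullet> (t \<bullet> (ginv G t \<bullet> ginv G s))"
    using Cmp_assoc[OF st c5] .
  also have "t \<bullet> (ginv G t \<bullet> ginv G s) = (t \<bullet> ginv G t) \<bullet> ginv G s"
    using Cmp_assoc[OF c2 c1] by simp
  also have "\<dots> = ginv G s" using i d Cmp_Cod[of "ginv G s"] by simp
  finally have 1: "(s \<bullet> t) \<bullet> (ginv G t \<bullet> ginv G s) = Cod G s" using i by simp
  have c6: "(ginv G s, s \<bullet> t) \<in> composable G"
    using st s i Cmp_closed Cod_Cmp by (simp add: composable_def)
  have "(ginv G t \<bullet> ginv G s) \<bullet> (s \<bullet> t) = ginv G t \<bullet> (ginv G s \<bullet> (s \<bullet> t))"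
    using Cmp_assoc[OF c1 c6] .
  also have "ginv G s \<bullet> (s \<bullet> t) = (ginv G s \<bullet> s) \<bullet> t"
    using Cmp_assoc[OF c3 st] by simp
  also have "\<dots> = t" using i d t Cmp_Cod[of t] by simp
  finally have 2: "(ginv G t \<bullet> ginv G s) \<bullet> (s \<bullet> t) = Dom G t" using i by simp
  have "is_inverse G (s \<bullet> t) (ginv G t \<bullet> ginv G s)"
    using 1 2 c1 st i Cmp_closed Dom_Cmp Cod_Cmp by (auto simp: is_inverse_def)
  then show ?thesis using is_inverse_unique is_inverse_ginv Cmp_closed[OF st] by blast
qed

end

context object_unital_rng
begin

lemma unity_of_component:
  assumes "e \<in> objects G" shows "is_unity_of R (Rg e) (unity_of R (Rg e))"
proof -
  obtain u where u: "is_unity_of R (Rg e) u" using unital[OF assms] by blast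
  have "v = u" if "is_unity_of R (Rg e) v" for v
    using u that unfolding is_unity_of_def by metis
  then show ?thesis unfolding unity_of_def using u by (metis theI)
qed

lemma component_subset: "s \<in> Mor G \<Longrightarrow> x \<in> Rg s \<Longrightarrow> x \<in> carrier R"
  using additive_subgroup.a_subset[OF component] by blast

lemma component_zero: "s \<in> Mor G \<Longrightarrow> \<zero> \<in> Rg s"
  using additive_subgroup.zero_closed[OF component] .

lemma degree_unique:
  assumes s: "s \<in> Mor G" "x \<in> Rg s" and t: "t \<in> Mor G" "x \<in> Rg t" and x: "x \<noteq> \<zero>"
  shows "s = t"
proof -
  define f where "f q = (\<lambda>p \<in> Mor G. if p = q then x else \<zero>)" for q
  have f: "f q \<in> (\<Pi>\<^sub>E s \<in> Mor G. Rg s) \<and> finite {s \<in> Mor G. f q s \<noteq> \<zero>} \<and>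
      x = (\<Oplus>s \<in> {s \<in> Mor G. f q s \<noteq> \<zero>}. f q s)" if q: "q \<in> Mor G" "x \<in> Rg q" for q
  proof -
    have supp: "{s \<in> Mor G. f q s \<noteq> \<zero>} = {q}" using q x by (auto simp: f_def)
    have "f q q = x" using q by (simp add: f_def)
    then have "(\<Oplus>s \<in> {q}. f q s) = x"
      using component_subset[OF q] by (simp add: finsum_insert)
    then show ?thesis using supp q component_zero by (auto simp: f_def)
  qed
  have "f s = f t"
    using direct_sum[OF component_subset[OF s]] f[OF s] f[OF t] by blast
  then have "f s s = f t s" by simp
  then show ?thesis using s x by (auto simp: f_def split: if_splits)
qed

lemma gdeg_eq:
  assumes "s \<in> Mor G" "x \<in> Rg s" "x \<noteq> \<zero>" shows "gdeg G Rg x = s"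
  unfolding gdeg_def using assms degree_unique by (intro the_equality) auto

end

locale object_unital_nonzero_rng = object_unital_rng +
  assumes unity_nonzero: "e \<in> objects G \<Longrightarrow> unity_of R (Rg e) \<noteq> \<zero>"
begin

lemma zero_mult:
  assumes "y \<in> carrier R" shows "\<zero> \<otimes> y = \<zero>"
proof -
  have c: "\<zero> \<otimes> y \<in> carrier R" using assms rng_m_closed by simp
  have "\<zero> \<otimes> y \<oplus> \<zero> \<otimes> y = \<zero> \<otimes> y"
    using rng_l_distr[of \<zero> \<zero> y] assms by simp
  then show ?thesis using c by (metis add.r_cancel_one')
qed

lemma object_invertible_nonzero:
  assumes s: "s \<in> Mor G" and x: "object_invertible G R Rg s x"
  shows "x \<noteq> \<zero>"
proof
  assume "x = \<zero>"
  moreover obtain y where "y \<in> Rg (ginv G s)" "x \<otimes> y = unity_of R (Rg (Cod G s))"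
    using x by (auto simp: object_invertible_def)
  ultimately show False
    using zero_mult component_subset ginv_simps(1)[OF s] unity_nonzero[OF Cod_objects[OF s]]
    by metis
qed

lemma gdeg_object_invertible:
  assumes "s \<in> Mor G" "object_invertible G R Rg s x"
  shows "gdeg G Rg x = s"
  using assms gdeg_eq object_invertible_nonzero by (auto simp: object_invertible_def)

lemma mem_unit_groupoid:
  assumes "x \<in> Mor (unit_groupoid G R Rg)"
  shows "gdeg G Rg x \<in> Mor G" "object_invertible G R Rg (gdeg G Rg x) x"
proof -
  obtain s where "s \<in> Mor G" "object_invertible G R Rg s x"
    using assms by (auto simp: unit_groupoid_def)
  then show "gdeg G Rg x \<in> Mor G" "object_invertible G R Rg (gdeg G Rg x) x"
    by (simp_all add: gdeg_object_invertible)
qed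

lemma unity_component_inj:
  assumes "e \<in> objects G" "f \<in> objects G" "unity_of R (Rg e) = unity_of R (Rg f)"
  shows "e = f"
  using assms unity_of_component unity_nonzero objects_simps(1) degree_unique
  by (metis is_unity_of_def)

lemma composable_unit_groupoid:
  "(x, y) \<in> composable (unit_groupoid G R Rg) \<longleftrightarrow>
     x \<in> Mor (unit_groupoid G R Rg) \<and> y \<in> Mor (unit_groupoid G R Rg) \<and>
     Dom G (gdeg G Rg x) = Cod G (gdeg G Rg y)"
  using unity_component_inj[OF Dom_objects Cod_objects, of "gdeg G Rg x" "gdeg G Rg y"]
    mem_unit_groupoid[of x] mem_unit_groupoid[of y]
  by (auto simp: composable_def unit_groupoid_def)

lemma object_invertible_unity:
  assumes "e \<in> objects G" shows "object_invertible G R Rg e (unity_of R (Rg e))"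
  using unity_of_component[OF assms] objects_simps[OF assms] ginv_object[OF assms]
  unfolding object_invertible_def is_unity_of_def by metis

lemma object_invertible_mult:
  assumes st: "(s, t) \<in> composable G"
    and x: "object_invertible G R Rg s x" and y: "object_invertible G R Rg t y"
  shows "object_invertible G R Rg (s \<bullet>\<^bsub>G\<^esub> t) (x \<otimes> y)"
proof -
  have s: "s \<in> Mor G" and t: "t \<in> Mor G" and d: "Dom G s = Cod G t"
    using st by (auto simp: composable_def)
  obtain x' where x': "x \<in> Rg s" "x' \<in> Rg (ginv G s)"
    "x \<otimes> x' = unity_of R (Rg (Cod G s))" "x' \<otimes> x = unity_of R (Rg (Dom G s))"
    using x by (auto simp: object_invertible_def)
  obtain y' where y': "y \<in> Rg t" "y' \<in> Rg (ginv G t)"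
    "y \<otimes> y' = unity_of R (Rg (Cod G t))" "y' \<otimes> y = unity_of R (Rg (Dom G t))"
    using y by (auto simp: object_invertible_def)
  have car: "x \<in> carrier R" "x' \<in> carrier R" "y \<in> carrier R" "y' \<in> carrier R"
    using x' y' s t ginv_simps component_subset by blast+
  have "(ginv G t, ginv G s) \<in> composable G"
    using ginv_simps s t d by (simp add: composable_def)
  then have mem: "y' \<otimes> x' \<in> Rg (ginv G (s \<bullet>\<^bsub>G\<^esub> t))"
    using graded_mult x' y' ginv_Cmp[OF st] by simp
  have "(x \<otimes> y) \<otimes> (y' \<otimes> x') = x \<otimes> ((y \<otimes> y') \<otimes> x')"
    using car by (simp add: rng_m_assoc rng_m_closed)
  also have "(y \<otimes> y') \<otimes> x' = x'"
    using y' x' d unity_left[of "ginv G s" x'] ginv_simps[OF s] by simp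
  finally have 1: "(x \<otimes> y) \<otimes> (y' \<otimes> x') = unity_of R (Rg (Cod G s))" using x' by simp
  have "(y' \<otimes> x') \<otimes> (x \<otimes> y) = y' \<otimes> ((x' \<otimes> x) \<otimes> y)"
    using car by (simp add: rng_m_assoc rng_m_closed)
  also have "(x' \<otimes> x) \<otimes> y = y"
    using x' y' d unity_left[of t y] t by simp
  finally have 2: "(y' \<otimes> x') \<otimes> (x \<otimes> y) = unity_of R (Rg (Dom G t))" using y' by simp
  show ?thesis
    using 1 2 mem graded_mult[OF st] x' y' Dom_Cmp[OF st] Cod_Cmp[OF st]
    by (auto simp: object_invertible_def)
qed

lemma object_inverse_object_invertible:
  assumes "s \<in> Mor G" "x \<in> Rg s" "y \<in> Rg (ginv G s)"
    "x \<otimes> y = unity_of R (Rg (Cod G s))" "y \<otimes> x = unity_of R (Rg (Dom G s))"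
  shows "object_invertible G R Rg (ginv G s) y"
  using assms ginv_simps[OF assms(1)] ginv_ginv[OF assms(1)]
  by (auto simp: object_invertible_def)

lemma unit_groupoid_unity:
  assumes "e \<in> objects G"
  shows "unity_of R (Rg e) \<in> Mor (unit_groupoid G R Rg)" "gdeg G Rg (unity_of R (Rg e)) = e"
  using object_invertible_unity[OF assms] objects_simps(1)[OF assms] gdeg_object_invertible
  by (auto simp: unit_groupoid_def)

lemma unit_groupoid_Cmp:
  assumes "(x, y) \<in> composable (unit_groupoid G R Rg)"
  shows "(gdeg G Rg x, gdeg G Rg y) \<in> composable G"
    "x \<otimes> y \<in> Mor (unit_groupoid G R Rg)"
    "gdeg G Rg (x \<otimes> y) = gdeg G Rg x \<bullet>\<^bsub>G\<^esub> gdeg G Rg y"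
proof -
  let ?s = "gdeg G Rg x" and ?t = "gdeg G Rg y"
  have x: "x \<in> Mor (unit_groupoid G R Rg)" and y: "y \<in> Mor (unit_groupoid G R Rg)"
    and d: "Dom G ?s = Cod G ?t"
    using assms by (auto simp: composable_unit_groupoid)
  show c: "(?s, ?t) \<in> composable G"
    using d mem_unit_groupoid(1)[OF x] mem_unit_groupoid(1)[OF y] by (simp add: composable_def)
  have i: "object_invertible G R Rg (?s \<bullet>\<^bsub>G\<^esub> ?t) (x \<otimes> y)"
    using object_invertible_mult[OF c] mem_unit_groupoid(2)[OF x] mem_unit_groupoid(2)[OF y] .
  show "x \<otimes> y \<in> Mor (unit_groupoid G R Rg)"
    using i Cmp_closed[OF c] by (auto simp: unit_groupoid_def)
  show "gdeg G Rg (x \<otimes> y) = ?s \<bullet>\<^bsub>G\<^esub> ?t"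
    using gdeg_object_invertible[OF Cmp_closed[OF c] i] .
qed

lemma gdeg_groupoid_hom: "gdeg G Rg \<in> groupoid_hom (unit_groupoid G R Rg) G"
  using mem_unit_groupoid(1) unit_groupoid_Cmp
  by (auto simp: groupoid_hom_def) (simp_all add: unit_groupoid_def)

theorem groupoid_unit_groupoid: "groupoid (unit_groupoid G R Rg)" (is "groupoid ?U")
proof -
  have Dom: "Dom ?U x = unity_of R (Rg (Dom G (gdeg G Rg x)))"
    and Cod: "Cod ?U x = unity_of R (Rg (Cod G (gdeg G Rg x)))"
    and Cmp: "x \<bullet>\<^bsub>?U\<^esub> y = x \<otimes> y" for x y
    by (simp_all add: unit_groupoid_def)
  have deg: "gdeg G Rg x \<in> Mor G" "x \<in> Rg (gdeg G Rg x)" if "x \<in> Mor ?U" for x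
    using mem_unit_groupoid[OF that] by (auto simp: object_invertible_def)
  have car: "x \<in> carrier R" if "x \<in> Mor ?U" for x
    using deg[OF that] component_subset by blast
  note D = unit_groupoid_unity[OF Dom_objects] unit_groupoid_unity[OF Cod_objects]
  show ?thesis
  proof
    fix s t assume st: "(s, t) \<in> composable ?U"
    then have mor: "s \<in> Mor ?U" "t \<in> Mor ?U" by (auto simp: composable_def)
    show "s \<bullet>\<^bsub>?U\<^esub> t \<in> Mor ?U" using unit_groupoid_Cmp[OF st] Cmp by simp
    show "Dom ?U (s \<bullet>\<^bsub>?U\<^esub> t) = Dom ?U t" "Cod ?U (s \<bullet>\<^bsub>?U\<^esub> t) = Cod ?U s"
      using unit_groupoid_Cmp[OF st] Dom_Cmp Cod_Cmp by (simp_all add: Dom Cod Cmp)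
    fix u assume tu: "(t, u) \<in> composable ?U"
    then have "u \<in> Mor ?U" by (auto simp: composable_def)
    then show "(s \<bullet>\<^bsub>?U\<^esub> t) \<bullet>\<^bsub>?U\<^esub> u = s \<bullet>\<^bsub>?U\<^esub> (t \<bullet>\<^bsub>?U\<^esub> u)"
      using mor car rng_m_assoc by (simp add: Cmp)
  next
    fix s assume s: "s \<in> Mor ?U"
    let ?d = "gdeg G Rg s"
    show "Dom ?U s \<in> Mor ?U" "Cod ?U s \<in> Mor ?U"
      using D deg[OF s] by (simp_all add: Dom Cod)
    show "Dom ?U (Dom ?U s) = Dom ?U s" "Cod ?U (Dom ?U s) = Dom ?U s"
      "Dom ?U (Cod ?U s) = Cod ?U s" "Cod ?U (Cod ?U s) = Cod ?U s"
      using D deg[OF s] Dom_Dom Cod_Dom Dom_Cod Cod_Cod by (simp_all add: Dom Cod)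
    show "s \<bullet>\<^bsub>?U\<^esub> Dom ?U s = s" "Cod ?U s \<bullet>\<^bsub>?U\<^esub> s = s"
      using deg[OF s] unity_left unity_right by (simp_all add: Dom Cod Cmp)
    obtain y where y: "y \<in> Rg (ginv G ?d)" "s \<otimes> y = unity_of R (Rg (Cod G ?d))"
      "y \<otimes> s = unity_of R (Rg (Dom G ?d))"
      using mem_unit_groupoid(2)[OF s] by (auto simp: object_invertible_def)
    have oi: "object_invertible G R Rg (ginv G ?d) y"
      using object_inverse_object_invertible deg[OF s] y by blast
    have gi: "ginv G ?d \<in> Mor G" using ginv_simps(1) deg(1)[OF s] by blast
    have "y \<in> Mor ?U" using oi gi by (auto simp: unit_groupoid_def)
    moreover have "gdeg G Rg y = ginv G ?d" using gdeg_object_invertible[OF gi oi] .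
    ultimately have "is_inverse ?U s y"
      using y ginv_simps[OF deg(1)[OF s]] by (simp add: is_inverse_def Dom Cod Cmp)
    then show "\<exists>t. is_inverse ?U s t" by blast
  qed
qed

end

end

theory Submission
  imports Defs
begin

text \<open>In a skew ring the monomials \<open>1 u\<^sub>s\<close> multiply like the morphisms \<open>s\<close>, which gives a
  splitting of the degree map. Conversely, let \<open>\<phi>\<close> be a splitting. Take \<open>R\<^sub>e\<close> as the coefficient
  ring at the object \<open>e\<close> and let \<open>s\<close> act by \<open>a \<mapsto> \<phi>(s) a \<phi>(s\<inverse>)\<close>. Since \<open>\<phi>(s)\<close> is
  invertible, \<open>R\<^sub>s = R\<^bsub>r(s)\<^esub> \<phi>(s)\<close>, so that \<open>x \<mapsto> \<Sum>\<^sub>s x\<^sub>s \<phi>(s\<inverse>) u\<^sub>s\<close> is a graded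
  isomorphism onto the skew ring.\<close>

section \<open>Finite sums in rings that need not have a unity\<close>

context rng
begin

lemma rng_l_null: "y \<in> carrier R \<Longrightarrow> \<zero> \<otimes> y = \<zero>"
  using rng_l_distr[of \<zero> \<zero> y] rng_m_closed[of \<zero> y] by (metis add.r_cancel_one' r_zero zero_closed)

lemma rng_r_null: "y \<in> carrier R \<Longrightarrow> y \<otimes> \<zero> = \<zero>"
  using rng_r_distr[of \<zero> \<zero> y] rng_m_closed[of y \<zero>] by (metis add.r_cancel_one' r_zero zero_closed)

text \<open>Induction on the index set. It serves for multiplication by a fixed element on either
  side and for projection to a homogeneous part.\<close>

lemma additive_map_finsum:
  assumes h: "h \<in> carrier R \<rightarrow> carrier R" "h \<zero> = \<zero>"
    "\<And>x y. x \<in> carrier R \<Longrightarrow> y \<in> carrier R \<Longrightarrow> h (x \<oplus> y) = h x \<oplus> h y"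
    and "finite I" "y \<in> I \<rightarrow> carrier R"
  shows "h (finsum R y I) = (\<Oplus>i\<in>I. h (y i))"
  using assms(4,5)
proof (induction I rule: finite_induct)
  case (insert i I)
  then have "(\<lambda>i. h (y i)) \<in> I \<rightarrow> carrier R" "h (y i) \<in> carrier R" "y i \<in> carrier R"
    "y \<in> I \<rightarrow> carrier R"
    using h(1) by auto
  then show ?case using insert h by (simp add: finsum_insert)
qed (simp add: h)

lemma rng_finsum_ldistr:
  assumes "finite I" "y \<in> I \<rightarrow> carrier R" "a \<in> carrier R"
  shows "finsum R y I \<otimes> a = (\<Oplus>i\<in>I. y i \<otimes> a)"
  using additive_map_finsum[of "\<lambda>x. x \<otimes> a"] assms
  by (simp add: rng_m_closed rng_l_null rng_l_distr Pi_def)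

lemma rng_finsum_rdistr:
  assumes "finite I" "y \<in> I \<rightarrow> carrier R" "a \<in> carrier R"
  shows "a \<otimes> finsum R y I = (\<Oplus>i\<in>I. a \<otimes> y i)"
  using additive_map_finsum[of "\<lambda>x. a \<otimes> x"] assms
  by (simp add: rng_m_closed rng_r_null rng_r_distr Pi_def)

lemma finsum_Times:
  assumes "finite I" "finite J" "\<And>i j. i \<in> I \<Longrightarrow> j \<in> J \<Longrightarrow> f i j \<in> carrier R"
  shows "(\<Oplus>i\<in>I. \<Oplus>j\<in>J. f i j) = finsum R (\<lambda>(i, j). f i j) (I \<times> J)"
  using assms(1,3)
proof (induction I rule: finite_induct)
  case (insert i I)
  have split: "insert i I \<times> J = Pair i ` J \<union> I \<times> J" by auto
  have "finsum R (\<lambda>(i, j). f i j) (insert i I \<times> J)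
      = finsum R (\<lambda>(i, j). f i j) (Pair i ` J) \<oplus> finsum R (\<lambda>(i, j). f i j) (I \<times> J)"
    unfolding split using insert assms(2) by (intro finsum_Un_disjoint) auto
  also have "finsum R (\<lambda>(i, j). f i j) (Pair i ` J) = (\<Oplus>j\<in>J. f i j)"
    using insert(4) by (subst finsum_reindex) (auto simp: inj_on_def)
  also have "finsum R (\<lambda>(i, j). f i j) (I \<times> J) = (\<Oplus>i\<in>I. \<Oplus>j\<in>J. f i j)"
    using insert by simp
  finally show ?case using insert
    by (subst finsum_insert) (auto intro!: finsum_closed)
qed simp

end


section \<open>Homogeneous parts\<close>

context object_unital_rng
begin

text \<open>The predicate from \<open>direct_sum\<close> under a name, so that its unique witness
  can be selected as \<open>part x\<close>.\<close>

definition "decomposition x f \<longleftrightarrow> f \<in> (\<Pi>\<^sub>E s \<in> Mor G. Rg s) \<and> finite {s \<in> Mor G. f s \<noteq> \<zero>} \<and>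
     x = (\<Oplus>s \<in> {s \<in> Mor G. f s \<noteq> \<zero>}. f s)"

definition "part x = (THE f. decomposition x f)"

lemma decomposition_part: "x \<in> carrier R \<Longrightarrow> decomposition x (part x)"
  unfolding part_def using direct_sum[of x] unfolding decomposition_def by (rule theI')

lemma part_eqI: "decomposition x f \<Longrightarrow> x \<in> carrier R \<Longrightarrow> part x = f"
  using direct_sum[of x] decomposition_part[of x] unfolding decomposition_def by blast

lemma part_mem: "x \<in> carrier R \<Longrightarrow> s \<in> Mor G \<Longrightarrow> part x s \<in> Rg s"
  using decomposition_part[of x] unfolding decomposition_def by auto

lemma part_closed: "x \<in> carrier R \<Longrightarrow> s \<in> Mor G \<Longrightarrow> part x s \<in> carrier R"
  using part_mem component_subset by blast

lemma finite_support_part: "x \<in> carrier R \<Longrightarrow> finite {s \<in> Mor G. part x s \<noteq> \<zero>}"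
  using decomposition_part[of x] unfolding decomposition_def by auto

text \<open>The additional terms are zero. This frees sums from the exact support, so that elements
  with different supports can be summed over a common index set.\<close>

lemma finsum_support:
  assumes "f \<in> (\<Pi>\<^sub>E s \<in> Mor G. Rg s)" "finite F" "F \<subseteq> Mor G" "{s \<in> Mor G. f s \<noteq> \<zero>} \<subseteq> F"
  shows "(\<Oplus>s \<in> {s \<in> Mor G. f s \<noteq> \<zero>}. f s) = (\<Oplus>s\<in>F. f s)"
  using assms component_subset by (intro add.finprod_mono_neutral_cong_left) fastforce+

lemma decompositionI:
  assumes "f \<in> (\<Pi>\<^sub>E s \<in> Mor G. Rg s)" "finite F" "F \<subseteq> Mor G" "{s \<in> Mor G. f s \<noteq> \<zero>} \<subseteq> F"
    "x = (\<Oplus>s\<in>F. f s)"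
  shows "decomposition x f"
  unfolding decomposition_def using finsum_support[OF assms(1-4)] assms finite_subset by auto

lemma finsum_part:
  assumes "x \<in> carrier R" "finite F" "F \<subseteq> Mor G" "{s \<in> Mor G. part x s \<noteq> \<zero>} \<subseteq> F"
  shows "x = (\<Oplus>s\<in>F. part x s)"
  using decomposition_part[OF assms(1)] finsum_support[OF _ assms(2-4)]
  unfolding decomposition_def by auto

lemma component_add: "s \<in> Mor G \<Longrightarrow> x \<in> Rg s \<Longrightarrow> y \<in> Rg s \<Longrightarrow> x \<oplus> y \<in> Rg s"
  using additive_subgroup.a_closed[OF component] .

lemma component_minus: "s \<in> Mor G \<Longrightarrow> x \<in> Rg s \<Longrightarrow> \<ominus> x \<in> Rg s"
  using additive_subgroup.a_inv_closed[OF component] .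

text \<open>By uniqueness of decompositions it suffices that the pointwise sum of the parts
  decomposes \<open>x \<oplus> y\<close>.\<close>

lemma part_add:
  assumes x: "x \<in> carrier R" and y: "y \<in> carrier R" and s: "s \<in> Mor G"
  shows "part (x \<oplus> y) s = part x s \<oplus> part y s"
proof -
  \<comment> \<open>Cancellation may shrink the support of the sum, but it always stays inside the
    union of both supports.\<close>
  let ?F = "{s \<in> Mor G. part x s \<noteq> \<zero>} \<union> {s \<in> Mor G. part y s \<noteq> \<zero>}"
  let ?f = "\<lambda>s \<in> Mor G. part x s \<oplus> part y s"
  have "finite ?F" using finite_support_part x y by simp
  then have "x \<oplus> y = (\<Oplus>s\<in>?F. part x s) \<oplus> (\<Oplus>s\<in>?F. part y s)"
    using finsum_part[of x ?F] finsum_part[of y ?F] x y by auto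
  also have "\<dots> = (\<Oplus>s\<in>?F. part x s \<oplus> part y s)"
    using part_closed x y by (intro finsum_addf[symmetric]) auto
  also have "\<dots> = (\<Oplus>s\<in>?F. ?f s)"
    using part_closed x y by (intro finsum_cong') auto
  finally have "decomposition (x \<oplus> y) ?f"
    using \<open>finite ?F\<close> part_mem component_add x y by (intro decompositionI[of ?f ?F]) auto
  then show ?thesis using part_eqI x y s by simp
qed

lemma part_homogeneous:
  assumes "s \<in> Mor G" "x \<in> Rg s" "t \<in> Mor G"
  shows "part x t = (if t = s then x else \<zero>)"
proof -
  have x: "x \<in> carrier R" using assms component_subset by blast
  have "decomposition x (\<lambda>t \<in> Mor G. if t = s then x else \<zero>)"
    using assms x component_zero
    by (intro decompositionI[of _ "{s}"]) (auto simp: finsum_insert)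
  then show ?thesis using part_eqI x assms by simp
qed

lemma part_zero: "t \<in> Mor G \<Longrightarrow> part \<zero> t = \<zero>"
  using part_homogeneous[of t \<zero> t] component_zero by simp

lemma part_finsum:
  assumes "finite I" "y \<in> I \<rightarrow> carrier R" "s \<in> Mor G"
  shows "part (finsum R y I) s = (\<Oplus>i\<in>I. part (y i) s)"
  using additive_map_finsum[of "\<lambda>x. part x s"] assms by (simp add: part_closed part_zero part_add)

lemma part_finsum_homogeneous:
  assumes f: "f \<in> (\<Pi>\<^sub>E s \<in> Mor G. Rg s)" and fin: "finite {s \<in> Mor G. f s \<noteq> \<zero>}"
  shows "part (\<Oplus>s \<in> {s \<in> Mor G. f s \<noteq> \<zero>}. f s) = f"
  using assms component_subset
  by (intro part_eqI) (auto simp: decomposition_def intro!: finsum_closed dest!: PiE_mem)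

lemma part_inject:
  assumes "x \<in> carrier R" "y \<in> carrier R" "\<And>s. s \<in> Mor G \<Longrightarrow> part x s = part y s"
  shows "x = y"
proof -
  have "part x = part y"
    using assms decomposition_part[of x] decomposition_part[of y] unfolding decomposition_def
    by (auto intro: PiE_ext)
  then show ?thesis
    using assms decomposition_part[of x] decomposition_part[of y] unfolding decomposition_def by metis
qed

text \<open>Both factors are expanded into parts and multiplied out; projection to degree
  \<open>p\<close> then selects terms. The index set has the shape of the one in the product of
  \<open>skew_ring\<close>, so that the two can be compared term by term.\<close>

lemma part_mult:
  assumes x: "x \<in> carrier R" and y: "y \<in> carrier R" and p: "p \<in> Mor G"
  shows "part (x \<otimes> y) p = finsum R (\<lambda>(s, t). part x s \<otimes> part y t)
    {(s, t) \<in> composable G. part x s \<noteq> \<zero> \<and> part y t \<noteq> \<zero> \<and> s \<bullet>\<^bsub>G\<^esub> t = p}"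
proof -
  let ?X = "{s \<in> Mor G. part x s \<noteq> \<zero>}" and ?Y = "{s \<in> Mor G. part y s \<noteq> \<zero>}"
  let ?P = "{(s, t) \<in> composable G. part x s \<noteq> \<zero> \<and> part y t \<noteq> \<zero> \<and> s \<bullet>\<^bsub>G\<^esub> t = p}"
  have fin: "finite ?X" "finite ?Y" using finite_support_part x y by auto
  have c: "part x s \<otimes> part y t \<in> carrier R" if "s \<in> Mor G" "t \<in> Mor G" for s t
    using rng_m_closed part_closed x y that by blast
  have "x \<otimes> y = (\<Oplus>s\<in>?X. part x s) \<otimes> y"
    using finsum_part[OF x fin(1)] by simp
  also have "\<dots> = (\<Oplus>s\<in>?X. part x s \<otimes> y)"
    using fin x y part_closed by (intro rng_finsum_ldistr) auto
  also have "\<dots> = (\<Oplus>s\<in>?X. \<Oplus>t\<in>?Y. part x s \<otimes> part y t)"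
  proof (intro finsum_cong')
    fix s assume s: "s \<in> ?X"
    have "part x s \<otimes> y = part x s \<otimes> (\<Oplus>t\<in>?Y. part y t)"
      using finsum_part[OF y fin(2)] by simp
    also have "\<dots> = (\<Oplus>t\<in>?Y. part x s \<otimes> part y t)"
      using s fin x y part_closed by (intro rng_finsum_rdistr) auto
    finally show "part x s \<otimes> y = (\<Oplus>t\<in>?Y. part x s \<otimes> part y t)" .
  qed (auto intro!: finsum_closed c)
  also have "\<dots> = finsum R (\<lambda>(s, t). part x s \<otimes> part y t) (?X \<times> ?Y)"
    using fin c by (intro finsum_Times) auto
  finally have "part (x \<otimes> y) p = (\<Oplus>q\<in>?X \<times> ?Y. part (case q of (s, t) \<Rightarrow> part x s \<otimes> part y t) p)"
    using fin c p by (simp add: part_finsum Pi_def split: prod.split)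
  \<comment> \<open>A term outside \<open>?P\<close> vanishes for one of two reasons: its degree
    differs from \<open>p\<close>, or its factors have non-composable degrees. On \<open>?P\<close>
    the product already lies in \<open>Rg p\<close>, so projecting does not change it.\<close>
  also have "\<dots> = finsum R (\<lambda>(s, t). part x s \<otimes> part y t) ?P"
  proof (intro add.finprod_mono_neutral_cong_right)
    show "finite (?X \<times> ?Y)" using fin by simp
    show "?P \<subseteq> ?X \<times> ?Y" by (auto simp: composable_def)
    show "(\<lambda>q. part (case q of (s, t) \<Rightarrow> part x s \<otimes> part y t) p) \<in> ?X \<times> ?Y \<rightarrow> carrier R"
      using c p part_closed by auto
    have mem: "part x s \<in> Rg s" "part y s \<in> Rg s" if "s \<in> Mor G" for s
      using part_mem x y that by auto
    show "part (case q of (s, t) \<Rightarrow> part x s \<otimes> part y t) p = \<zero>" if q: "q \<in> ?X \<times> ?Y - ?P" for q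
    proof -
      obtain s t where st: "q = (s, t)" "s \<in> ?X" "t \<in> ?Y" using q by auto
      show ?thesis
      proof (cases "(s, t) \<in> composable G")
        case True
        then have "s \<bullet>\<^bsub>G\<^esub> t \<noteq> p" using q st by auto
        then show ?thesis
          using part_homogeneous[OF Cmp_closed[OF True] graded_mult[OF True] p] mem st by auto
      next
        case False
        then have "part x s \<otimes> part y t = \<zero>" using graded_mult_zero mem st by blast
        then show ?thesis using st part_zero p by simp
      qed
    qed
    show "part (case q of (s, t) \<Rightarrow> part x s \<otimes> part y t) p = (case q of (s, t) \<Rightarrow> part x s \<otimes> part y t)"
      if q: "q \<in> ?P" for q
    proof -
      obtain s t where st: "q = (s, t)" "(s, t) \<in> composable G" "s \<bullet>\<^bsub>G\<^esub> t = p" using q by auto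
      then have "part x s \<otimes> part y t \<in> Rg p"
        using graded_mult mem by (auto simp: composable_def)
      then show ?thesis using part_homogeneous p st by simp
    qed
  qed
  finally show ?thesis .
qed

end

section \<open>A multiplicative section makes the ring a skew ring\<close>

text \<open>What a splitting provides, expressed inside the ring without the unit groupoid. That the
  values are object invertible is recovered in \<open>section_ginv\<close>.\<close>

locale graded_section = object_unital_nonzero_rng +
  fixes \<phi>
  assumes section_mem: "s \<in> Mor G \<Longrightarrow> \<phi> s \<in> Rg s"
    and section_mult: "(s, t) \<in> composable G \<Longrightarrow> \<phi> s \<otimes> \<phi> t = \<phi> (s \<bullet>\<^bsub>G\<^esub> t)"
    and section_unity: "e \<in> objects G \<Longrightarrow> \<phi> e = unity_of R (Rg e)"
begin

lemma section_closed: "s \<in> Mor G \<Longrightarrow> \<phi> s \<in> carrier R"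
  using section_mem component_subset by blast

lemma section_ginv:
  assumes s: "s \<in> Mor G"
  shows "\<phi> s \<otimes> \<phi> (ginv G s) = unity_of R (Rg (Cod G s))"
    "\<phi> (ginv G s) \<otimes> \<phi> s = unity_of R (Rg (Dom G s))"
proof -
  have "(s, ginv G s) \<in> composable G" "(ginv G s, s) \<in> composable G"
    using ginv_simps[OF s] s by (auto simp: composable_def)
  then show "\<phi> s \<otimes> \<phi> (ginv G s) = unity_of R (Rg (Cod G s))"
    "\<phi> (ginv G s) \<otimes> \<phi> s = unity_of R (Rg (Dom G s))"
    using ginv_simps[OF s] section_mult section_unity Cod_objects Dom_objects s by simp_all
qed

text \<open>Together with \<open>coefficient_times_section\<close> this says that right
  multiplication by \<open>\<phi> (ginv G s)\<close> and by \<open>\<phi> s\<close> are mutually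
  inverse bijections between \<open>Rg s\<close> and \<open>Rg (Cod G s)\<close>. The inner factor
  cancels to a local unity.\<close>

lemma component_times_section_ginv:
  assumes s: "s \<in> Mor G" and x: "x \<in> Rg s"
  shows "x \<otimes> \<phi> (ginv G s) \<in> Rg (Cod G s)" "x \<otimes> \<phi> (ginv G s) \<otimes> \<phi> s = x"
proof -
  have "(s, ginv G s) \<in> composable G"
    using ginv_simps[OF s] s by (auto simp: composable_def)
  then show "x \<otimes> \<phi> (ginv G s) \<in> Rg (Cod G s)"
    using graded_mult[of s "ginv G s" x] section_mem ginv_simps[OF s] x by fastforce
  show "x \<otimes> \<phi> (ginv G s) \<otimes> \<phi> s = x"
    using section_ginv[OF s] s x ginv_simps[OF s] section_closed component_subset unity_right
    by (simp add: rng_m_assoc)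
qed

lemma coefficient_times_section:
  assumes s: "s \<in> Mor G" and a: "a \<in> Rg (Cod G s)"
  shows "a \<otimes> \<phi> s \<in> Rg s" "a \<otimes> \<phi> s \<otimes> \<phi> (ginv G s) = a"
proof -
  have "(Cod G s, s) \<in> composable G"
    using s Cod_closed Dom_Cod by (simp add: composable_def)
  then show "a \<otimes> \<phi> s \<in> Rg s"
    using graded_mult[of "Cod G s" s a] section_mem a s Cmp_Cod by fastforce
  have "a \<in> carrier R" using a s Cod_closed component_subset by blast
  then show "a \<otimes> \<phi> s \<otimes> \<phi> (ginv G s) = a"
    using section_ginv[OF s] s a ginv_simps[OF s] section_closed Cod_closed Dom_Cod
      unity_right[of "Cod G s" a]
    by (simp add: rng_m_assoc)
qed

section \<open>The coefficient rings and the action of the groupoid on them\<close>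

definition "coefficient_ring e =
  \<lparr>carrier = Rg e, mult = mult R, one = unity_of R (Rg e), zero = \<zero>, add = add R\<rparr>"

definition "conjugation s a = \<phi> s \<otimes> a \<otimes> \<phi> (ginv G s)"

text \<open>The value at \<open>s\<close> is the element \<open>a\<close> of
  \<open>Rg (Cod G s)\<close> with \<open>a \<otimes> \<phi> s = part x s\<close>.\<close>

definition "coefficients x = (\<lambda>s \<in> Mor G. part x s \<otimes> \<phi> (ginv G s))"

lemma coefficient_ring_simps [simp]:
  "carrier (coefficient_ring e) = Rg e" "mult (coefficient_ring e) = mult R"
  "one (coefficient_ring e) = unity_of R (Rg e)" "zero (coefficient_ring e) = \<zero>"
  "add (coefficient_ring e) = add R"
  by (simp_all add: coefficient_ring_def)

text \<open>An object composed with itself is itself, so \<open>Rg e\<close> is closed under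
  products. Its unity is the local one; associativity, distributivity and the laws of addition are
  inherited from \<open>R\<close>.\<close>

lemma ring_coefficient_ring:
  assumes e: "e \<in> objects G"
  shows "ring (coefficient_ring e)"
proof -
  note M = objects_simps(1)[OF e]
  note c = component_subset[OF M]
  have ee: "(e, e) \<in> composable G" "e \<bullet>\<^bsub>G\<^esub> e = e"
    using objects_simps[OF e] Cmp_Dom[OF M] by (auto simp: composable_def)
  show ?thesis
  proof (intro ringI abelian_groupI monoidI)
    show "\<exists>y\<in>carrier (coefficient_ring e). y \<oplus>\<^bsub>coefficient_ring e\<^esub> x = \<zero>\<^bsub>coefficient_ring e\<^esub>"
      if "x \<in> carrier (coefficient_ring e)" for x
      using that component_minus[OF M, of x] c l_neg by auto
  qed (use unity_of_component[OF e] graded_mult[OF ee(1)] ee(2) component_add[OF M]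
      component_zero[OF M] c
      in \<open>auto simp: is_unity_of_def rng_m_assoc a_ac rng_l_distr rng_r_distr\<close>)
qed

text \<open>Needed because the product in the skew ring sums in a coefficient ring, while
  \<open>part_mult\<close> sums in \<open>R\<close>. Both share zero and addition.\<close>

lemma finsum_coefficient_ring:
  assumes e: "e \<in> objects G" and f: "f \<in> I \<rightarrow> Rg e"
  shows "finsum (coefficient_ring e) f I = finsum R f I"
proof -
  interpret A: ring "coefficient_ring e" using ring_coefficient_ring[OF e] .
  show ?thesis
    using f
  proof (induction I rule: infinite_finite_induct)
    \<comment> \<open>Both sums take the same default value zero here.\<close>
    case (infinite I)
    then show ?case using A.finsum_infinite finsum_infinite by simp
  next
    case empty
    show ?case using A.finsum_empty finsum_empty by simp
  next
    case (insert i I)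
    have f: "f \<in> I \<rightarrow> Rg e" "f i \<in> Rg e" using insert.prems by auto
    then have "f \<in> I \<rightarrow> carrier R" "f i \<in> carrier R"
      using component_subset[OF objects_simps(1)[OF e]] by auto
    then show ?case
      using insert f A.finsum_insert[of I i f] finsum_insert[of I i f] by simp
  qed
qed

lemma conjugation_closed:
  assumes s: "s \<in> Mor G" and a: "a \<in> Rg (Dom G s)"
  shows "conjugation s a \<in> Rg (Cod G s)"
proof -
  have "(s, Dom G s) \<in> composable G"
    using s Dom_closed Cod_Dom by (simp add: composable_def)
  then have "\<phi> s \<otimes> a \<in> Rg s"
    using graded_mult[of s "Dom G s" "\<phi> s" a] section_mem[OF s] a s Cmp_Dom by fastforce
  then show ?thesis
    unfolding conjugation_def using component_times_section_ginv s by blast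
qed

lemma conjugation_object:
  assumes e: "e \<in> objects G" and a: "a \<in> Rg e"
  shows "conjugation e a = a"
  using unity_of_component[OF e] a section_unity[OF e] ginv_object[OF e]
  by (simp add: conjugation_def is_unity_of_def)

text \<open>Since \<open>ginv G\<close> reverses products, the factors on the left merge by
  multiplicativity of \<open>\<phi>\<close>, and so do those on the right.\<close>

lemma conjugation_Cmp:
  assumes st: "(s, t) \<in> composable G" and a: "a \<in> Rg (Dom G t)"
  shows "conjugation s (conjugation t a) = conjugation (s \<bullet>\<^bsub>G\<^esub> t) a"
proof -
  have s: "s \<in> Mor G" and t: "t \<in> Mor G" using st by (auto simp: composable_def)
  have c: "a \<in> carrier R" using a t Dom_closed component_subset by blast
  have "(ginv G t, ginv G s) \<in> composable G"
    using st ginv_simps[OF s] ginv_simps[OF t] by (simp add: composable_def)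
  then have "\<phi> (ginv G (s \<bullet>\<^bsub>G\<^esub> t)) = \<phi> (ginv G t) \<otimes> \<phi> (ginv G s)"
    using ginv_Cmp[OF st] section_mult by simp
  then show ?thesis
    using c s t ginv_simps(1) section_closed section_mult[OF st, symmetric]
    by (simp add: conjugation_def rng_m_assoc rng_m_closed)
qed

text \<open>In a product of two conjugates the inner factors
  \<open>\<phi> (ginv G s) \<otimes> \<phi> s\<close> collapse to a local unity. The inverse map is
  conjugation by \<open>ginv G s\<close>, because the two compose to conjugation by an object, which
  is the identity.\<close>

lemma conjugation_ring_iso:
  assumes s: "s \<in> Mor G"
  shows "conjugation s \<in> ring_iso (coefficient_ring (Dom G s)) (coefficient_ring (Cod G s))"
proof -
  note g = ginv_simps[OF s]
  have car: "x \<in> carrier R" if "x \<in> Rg (Dom G s)" for x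
    using that Dom_closed[OF s] component_subset by blast
  have p: "\<phi> s \<in> carrier R" "\<phi> (ginv G s) \<in> carrier R" using section_closed s g by auto
  have comp: "(s, ginv G s) \<in> composable G" "(ginv G s, s) \<in> composable G"
    using g s by (auto simp: composable_def)
  show ?thesis
  proof (rule ring_iso_memI)
    fix x y
    assume "x \<in> carrier (coefficient_ring (Dom G s))" "y \<in> carrier (coefficient_ring (Dom G s))"
    then have x: "x \<in> Rg (Dom G s)" and y: "y \<in> Rg (Dom G s)" by simp_all
    show "conjugation s x \<in> carrier (coefficient_ring (Cod G s))"
      using conjugation_closed[OF s x] by simp
    show "conjugation s (x \<oplus>\<^bsub>coefficient_ring (Dom G s)\<^esub> y)
        = conjugation s x \<oplus>\<^bsub>coefficient_ring (Cod G s)\<^esub> conjugation s y"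
      using car[OF x] car[OF y] p
      by (simp add: conjugation_def rng_l_distr rng_r_distr rng_m_closed)
    have "conjugation s x \<otimes> conjugation s y
        = \<phi> s \<otimes> x \<otimes> (\<phi> (ginv G s) \<otimes> \<phi> s \<otimes> y) \<otimes> \<phi> (ginv G s)"
      using car[OF x] car[OF y] p by (simp add: conjugation_def rng_m_assoc rng_m_closed)
    also have "\<phi> (ginv G s) \<otimes> \<phi> s \<otimes> y = y"
      using section_ginv(2)[OF s] unity_left[of "Dom G s" y] y Dom_closed[OF s] Cod_Dom[OF s] by simp
    finally show "conjugation s (x \<otimes>\<^bsub>coefficient_ring (Dom G s)\<^esub> y)
        = conjugation s x \<otimes>\<^bsub>coefficient_ring (Cod G s)\<^esub> conjugation s y"
      using car[OF x] car[OF y] p by (simp add: conjugation_def rng_m_assoc rng_m_closed)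
  next
    show "conjugation s \<one>\<^bsub>coefficient_ring (Dom G s)\<^esub> = \<one>\<^bsub>coefficient_ring (Cod G s)\<^esub>"
      using unity_right[OF s section_mem[OF s]] section_ginv[OF s] by (simp add: conjugation_def)
    have "bij_betw (conjugation s) (Rg (Dom G s)) (Rg (Cod G s))"
    proof (rule bij_betwI[where g = "conjugation (ginv G s)"])
      show "conjugation s \<in> Rg (Dom G s) \<rightarrow> Rg (Cod G s)"
        "conjugation (ginv G s) \<in> Rg (Cod G s) \<rightarrow> Rg (Dom G s)"
        using conjugation_closed[OF s] conjugation_closed[OF g(1)] g by auto
      show "conjugation (ginv G s) (conjugation s x) = x" if "x \<in> Rg (Dom G s)" for x
        using conjugation_Cmp[OF comp(2) that] g conjugation_object[OF Dom_objects[OF s] that] by simp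
      show "conjugation s (conjugation (ginv G s) x) = x" if "x \<in> Rg (Cod G s)" for x
        using conjugation_Cmp[OF comp(1), of x] that g
          conjugation_object[OF Cod_objects[OF s] that] by simp
    qed
    then show "bij_betw (conjugation s) (carrier (coefficient_ring (Dom G s)))
        (carrier (coefficient_ring (Cod G s)))" by simp
  qed
qed

lemma object_skew_system_conjugation: "object_skew_system G coefficient_ring conjugation"
  using groupoid_axioms ring_coefficient_ring unity_nonzero conjugation_ring_iso
    conjugation_object conjugation_Cmp
  by (simp add: object_skew_system_def object_skew_system_axioms_def)

section \<open>The coefficient map is a graded isomorphism\<close>

abbreviation "skew \<equiv> skew_ring G coefficient_ring conjugation"

lemma part_times_section_ginv:
  assumes "x \<in> carrier R" "s \<in> Mor G"
  shows "part x s \<otimes> \<phi> (ginv G s) \<in> Rg (Cod G s)" "part x s \<otimes> \<phi> (ginv G s) \<otimes> \<phi> s = part x s"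
  using component_times_section_ginv[OF assms(2) part_mem[OF assms]] .

text \<open>Multiplying by \<open>\<phi> (ginv G s)\<close> is undone by \<open>\<phi> s\<close>, so
  it annihilates no nonzero part. Hence the index sets of the two product formulas agree.\<close>

lemma skew_support_coefficients:
  assumes x: "x \<in> carrier R"
  shows "skew_support G coefficient_ring (coefficients x) = {s \<in> Mor G. part x s \<noteq> \<zero>}"
proof -
  have "part x s \<otimes> \<phi> (ginv G s) = \<zero> \<longleftrightarrow> part x s = \<zero>" if s: "s \<in> Mor G" for s
    using part_times_section_ginv[OF x s] rng_l_null section_closed s ginv_simps(1)[OF s] by metis
  then show ?thesis by (auto simp: skew_support_def coefficients_def)
qed

lemma coefficients_closed:
  assumes x: "x \<in> carrier R"
  shows "coefficients x \<in> carrier skew"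
  using skew_support_coefficients[OF x] finite_support_part[OF x] part_times_section_ginv[OF x]
  by (auto simp: skew_ring_def coefficients_def)

lemma coefficients_add:
  assumes "x \<in> carrier R" "y \<in> carrier R"
  shows "coefficients (x \<oplus> y) = coefficients x \<oplus>\<^bsub>skew\<^esub> coefficients y"
  using assms part_add part_closed section_closed ginv_simps(1)
  by (auto simp: skew_ring_def coefficients_def rng_l_distr intro!: restrict_ext)

text \<open>The factor \<open>\<phi> (ginv G s)\<close> of the left coefficient cancels against the \<open>\<phi> s\<close> of the conjugation.\<close>

lemma coefficient_mult_conjugation:
  assumes st: "(s, t) \<in> composable G" and x: "x \<in> Rg s" and y: "y \<in> Rg t"
  shows "x \<otimes> \<phi> (ginv G s) \<otimes> conjugation s (y \<otimes> \<phi> (ginv G t))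
    = x \<otimes> y \<otimes> \<phi> (ginv G (s \<bullet>\<^bsub>G\<^esub> t))"
proof -
  have s: "s \<in> Mor G" and t: "t \<in> Mor G" using st by (auto simp: composable_def)
  note g = ginv_simps(1)[OF s] ginv_simps(1)[OF t]
  have c: "x \<in> carrier R" "y \<in> carrier R" using x y s t component_subset by auto
  have "(ginv G t, ginv G s) \<in> composable G"
    using st ginv_simps[OF s] ginv_simps[OF t] by (simp add: composable_def)
  then have "\<phi> (ginv G (s \<bullet>\<^bsub>G\<^esub> t)) = \<phi> (ginv G t) \<otimes> \<phi> (ginv G s)"
    using ginv_Cmp[OF st] section_mult by simp
  moreover have "x \<otimes> \<phi> (ginv G s) \<otimes> conjugation s (y \<otimes> \<phi> (ginv G t))
      = (x \<otimes> \<phi> (ginv G s) \<otimes> \<phi> s) \<otimes> (y \<otimes> (\<phi> (ginv G t) \<otimes> \<phi> (ginv G s)))"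
    using c s t g section_closed by (simp add: conjugation_def rng_m_assoc rng_m_closed)
  ultimately show ?thesis
    using component_times_section_ginv(2)[OF s x] c s t g section_closed
    by (simp add: rng_m_assoc rng_m_closed)
qed

text \<open>At each \<open>p\<close> the sums of \<open>part_mult\<close> and of the skew product
  run over the same pairs, and \<open>coefficient_mult_conjugation\<close> matches their terms up to
  the common right factor \<open>\<phi> (ginv G p)\<close>.\<close>

lemma coefficients_mult:
  assumes x: "x \<in> carrier R" and y: "y \<in> carrier R"
  shows "coefficients (x \<otimes> y) = coefficients x \<otimes>\<^bsub>skew\<^esub> coefficients y"
proof -
  have "part (x \<otimes> y) p \<otimes> \<phi> (ginv G p) = (coefficients x \<otimes>\<^bsub>skew\<^esub> coefficients y) p"
    if p: "p \<in> Mor G" for p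
  proof -
    let ?P = "{(s, t) \<in> composable G. part x s \<noteq> \<zero> \<and> part y t \<noteq> \<zero> \<and> s \<bullet>\<^bsub>G\<^esub> t = p}"
    let ?g = "\<lambda>(s, t). coefficients x s \<otimes> conjugation s (coefficients y t)"
    have P: "?P = {(s, t) \<in> composable G. s \<in> skew_support G coefficient_ring (coefficients x) \<and>
        t \<in> skew_support G coefficient_ring (coefficients y) \<and> s \<bullet>\<^bsub>G\<^esub> t = p}"
      using skew_support_coefficients x y by (auto simp: composable_def)
    have "?P \<subseteq> {s \<in> Mor G. part x s \<noteq> \<zero>} \<times> {s \<in> Mor G. part y s \<noteq> \<zero>}"
      by (auto simp: composable_def)
    then have fin: "finite ?P"
      using finite_support_part x y by (meson finite_SigmaI finite_subset)
    have mem: "part x s \<otimes> part y t \<in> Rg p" if "(s, t) \<in> ?P" for s t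
      using that graded_mult part_mem x y by (auto simp: composable_def)
    have g: "?g (s, t) = part x s \<otimes> part y t \<otimes> \<phi> (ginv G p)" if "(s, t) \<in> ?P" for s t
      using that coefficient_mult_conjugation[of s t] part_mem x y
      by (auto simp: composable_def coefficients_def)
    \<comment> \<open>Membership in the component, not merely in the carrier of \<open>R\<close>, is
      what allows the sum to pass to the coefficient ring.\<close>
    have gR: "?g \<in> ?P \<rightarrow> Rg (Cod G p)"
    proof
      fix q assume q: "q \<in> ?P"
      obtain s t where st: "q = (s, t)" by (cases q)
      show "?g q \<in> Rg (Cod G p)"
        using g[of s t] component_times_section_ginv(1)[OF p mem[of s t]] q unfolding st by simp
    qed
    have "part (x \<otimes> y) p \<otimes> \<phi> (ginv G p)
        = finsum R (\<lambda>(s, t). part x s \<otimes> part y t) ?P \<otimes> \<phi> (ginv G p)"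
      using part_mult[OF x y p] by simp
    also have "\<dots> = finsum R (\<lambda>q. (case q of (s, t) \<Rightarrow> part x s \<otimes> part y t) \<otimes> \<phi> (ginv G p)) ?P"
      using fin mem component_subset[OF p] section_closed ginv_simps(1)[OF p]
      by (intro rng_finsum_ldistr) auto
    also have "\<dots> = finsum R ?g ?P"
    proof (intro finsum_cong')
      show "?g \<in> ?P \<rightarrow> carrier R"
        by (rule subsetD[OF Pi_mono gR]) (use component_subset[OF Cod_closed[OF p]] in blast)
      show "(case q of (s, t) \<Rightarrow> part x s \<otimes> part y t) \<otimes> \<phi> (ginv G p) = ?g q" if "q \<in> ?P" for q
        using g[of "fst q" "snd q"] that by (cases q) simp
    qed simp
    also have "\<dots> = finsum (coefficient_ring (Cod G p)) ?g ?P"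
      using finsum_coefficient_ring[OF Cod_objects[OF p] gR] by simp
    also have "\<dots> = (coefficients x \<otimes>\<^bsub>skew\<^esub> coefficients y) p"
      unfolding P using p by (simp add: skew_ring_def)
    finally show ?thesis .
  qed
  \<comment> \<open>Outside \<open>Mor G\<close> both functions are
    \<open>undefined\<close>.\<close>
  then show ?thesis
    by (intro ext) (auto simp: coefficients_def skew_ring_def)
qed

lemma coefficients_inj: "inj_on coefficients (carrier R)"
proof (rule inj_onI)
  fix x y assume x: "x \<in> carrier R" and y: "y \<in> carrier R" and eq: "coefficients x = coefficients y"
  have "part x s \<otimes> \<phi> (ginv G s) = part y s \<otimes> \<phi> (ginv G s)" if "s \<in> Mor G" for s
    using that fun_cong[OF eq, of s] by (simp add: coefficients_def)
  then show "x = y"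
    using part_inject[OF x y] part_times_section_ginv(2) x y by metis
qed

lemma coefficients_surj:
  assumes f: "f \<in> carrier skew"
  obtains x where "x \<in> carrier R" "coefficients x = f"
proof -
  \<comment> \<open>The parts that a preimage must have: each coefficient is moved back into its own
    degree by \<open>\<phi> s\<close>.\<close>
  let ?g = "\<lambda>s \<in> Mor G. f s \<otimes> \<phi> s"
  have fm: "f s \<in> Rg (Cod G s)" if "s \<in> Mor G" for s
    using f that by (auto simp: skew_ring_def)
  have "{s \<in> Mor G. ?g s \<noteq> \<zero>} \<subseteq> skew_support G coefficient_ring f"
    using rng_l_null section_closed by (auto simp: skew_support_def)
  moreover have "finite (skew_support G coefficient_ring f)"
    using f by (simp add: skew_ring_def)
  ultimately have fin: "finite {s \<in> Mor G. ?g s \<noteq> \<zero>}" by (rule finite_subset)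
  have g: "?g \<in> (\<Pi>\<^sub>E s \<in> Mor G. Rg s)"
    using coefficient_times_section(1) fm by auto
  define x where "x = (\<Oplus>s \<in> {s \<in> Mor G. ?g s \<noteq> \<zero>}. ?g s)"
  have x: "x \<in> carrier R"
    unfolding x_def using coefficient_times_section(1) fm component_subset
    by (intro finsum_closed) auto
  have p: "part x = ?g"
    unfolding x_def using part_finsum_homogeneous[OF g fin] .
  have "coefficients x = f"
  proof
    fix s show "coefficients x s = f s"
      using f fm coefficient_times_section(2)
      by (cases "s \<in> Mor G") (auto simp: coefficients_def p skew_ring_def PiE_def extensional_def)
  qed
  then show thesis using that x by simp
qed

text \<open>For the harder inclusion, the preimage of a function supported at \<open>s\<close> has
  no part other than the one at \<open>s\<close>, so it equals that part.\<close>

lemma coefficients_component: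
  assumes s: "s \<in> Mor G"
  shows "coefficients ` Rg s = skew_component G coefficient_ring conjugation s"
proof
  show "coefficients ` Rg s \<subseteq> skew_component G coefficient_ring conjugation s"
  proof
    fix f assume "f \<in> coefficients ` Rg s"
    then obtain x where x: "x \<in> Rg s" and f: "f = coefficients x" by blast
    have c: "x \<in> carrier R" using x s component_subset by blast
    show "f \<in> skew_component G coefficient_ring conjugation s"
      using coefficients_closed[OF c] skew_support_coefficients[OF c] part_homogeneous[OF s x]
      by (auto simp: skew_component_def f split: if_splits)
  qed
  show "skew_component G coefficient_ring conjugation s \<subseteq> coefficients ` Rg s"
  proof
    fix f assume "f \<in> skew_component G coefficient_ring conjugation s"
    then have f: "f \<in> carrier skew" and supp: "skew_support G coefficient_ring f \<subseteq> {s}"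
      by (auto simp: skew_component_def)
    obtain x where x: "x \<in> carrier R" "coefficients x = f" using coefficients_surj[OF f] .
    have "{t \<in> Mor G. part x t \<noteq> \<zero>} \<subseteq> {s}"
      using supp skew_support_coefficients[OF x(1)] x(2) by simp
    then have "x = (\<Oplus>t\<in>{s}. part x t)" using finsum_part[OF x(1)] s by simp
    then have "x = part x s" using part_closed[OF x(1) s] by (simp add: finsum_insert)
    then have "x \<in> Rg s" using part_mem[OF x(1) s] by simp
    then show "f \<in> coefficients ` Rg s" using x by blast
  qed
qed

lemma coefficients_graded_iso:
  "coefficients \<in> graded_iso G R Rg skew (skew_component G coefficient_ring conjugation)"
proof -
  have "coefficients ` carrier R = carrier skew"
    using coefficients_closed coefficients_surj by (blast elim: coefficients_surj)
  then show ?thesis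
    using coefficients_inj coefficients_closed coefficients_add coefficients_mult coefficients_component
    by (auto simp: graded_iso_def iso_def hom_def bij_betw_def)
qed

end


section \<open>Skew rings split\<close>

context object_skew_system
begin

text \<open>Away from \<open>s\<close> the values are zero on \<open>Mor G\<close> and
  \<open>undefined\<close> elsewhere, as in a monomial.\<close>

lemma skew_component_eq_monomial:
  assumes s: "s \<in> Mor G" and f: "f \<in> skew_component G A \<alpha> s"
  shows "f s \<in> carrier (A (Cod G s))" "f = monomial s (f s)"
proof -
  have "f \<in> (\<Pi>\<^sub>E s \<in> Mor G. carrier (A (Cod G s)))" "skew_support G A f \<subseteq> {s}"
    using f by (auto simp: skew_component_def skew_ring_def)
  then show "f s \<in> carrier (A (Cod G s))" "f = monomial s (f s)"
    using s by (auto simp: monomial_def skew_support_def PiE_def extensional_def intro!: ext)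
qed

lemma monomial_mem_skew_component:
  assumes s: "s \<in> Mor G" and a: "a \<in> carrier (A (Cod G s))"
  shows "monomial s a \<in> skew_component G A \<alpha> s"
proof -
  have "\<zero>\<^bsub>A (Cod G p)\<^esub> \<in> carrier (A (Cod G p))" if "p \<in> Mor G" for p
    using that A_ring Cod_objects ring.ring_simprules(2) by blast
  then show ?thesis
    using s a skew_support_monomial[OF s, of a]
    by (auto simp: skew_component_def skew_ring_def monomial_def)
qed

end

context object_unital_nonzero_rng
begin

text \<open>The splitting sends \<open>s\<close> to the preimage of the monomial with coefficient
  one at \<open>s\<close>. The type of the coefficients stays arbitrary so that different types can
  be substituted later.\<close>

lemma skew_ring_splits:
  fixes T :: "'x itself"
  assumes "is_object_skew_groupoid_ring T G R Rg"
  shows "splits (unit_groupoid G R Rg) G (gdeg G Rg)"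
proof -
  obtain A :: "_ \<Rightarrow> 'x ring" and \<alpha> h where sys: "object_skew_system G A \<alpha>"
    and h: "h \<in> graded_iso G R Rg (skew_ring G A \<alpha>) (skew_component G A \<alpha>)"
    using assms unfolding is_object_skew_groupoid_ring_def by blast
  interpret object_skew_system G A \<alpha> using sys .
  have inj: "inj_on h (carrier R)"
    and hm: "h (x \<otimes> y) = h x \<otimes>\<^bsub>skew_ring G A \<alpha>\<^esub> h y" if "x \<in> carrier R" "y \<in> carrier R" for x y
    using h that by (auto simp: graded_iso_def iso_def bij_betw_def hom_def)
  have hR: "h ` Rg s = skew_component G A \<alpha> s" if "s \<in> Mor G" for s
    using h that by (auto simp: graded_iso_def)
  have one: "\<one>\<^bsub>A (Cod G s)\<^esub> \<in> carrier (A (Cod G s))" if "s \<in> Mor G" for s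
    using that A_ring Cod_objects ring.ring_simprules(6) by blast
  have "\<exists>x\<in>Rg s. h x = monomial s \<one>\<^bsub>A (Cod G s)\<^esub>" if s: "s \<in> Mor G" for s
    using monomial_mem_skew_component[OF s one[OF s]] hR[OF s] by (metis imageE)
  then obtain \<phi> where \<phi>: "\<phi> s \<in> Rg s" "h (\<phi> s) = monomial s \<one>\<^bsub>A (Cod G s)\<^esub>"
    if "s \<in> Mor G" for s
    by metis
  have c: "\<phi> s \<in> carrier R" if "s \<in> Mor G" for s using \<phi> that component_subset by blast
  have mult: "\<phi> s \<otimes> \<phi> t = \<phi> (s \<bullet>\<^bsub>G\<^esub> t)" if st: "(s, t) \<in> composable G" for s t
  proof -
    have s: "s \<in> Mor G" and t: "t \<in> Mor G" and d: "Dom G s = Cod G t"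
      using st by (auto simp: composable_def)
    interpret C: ring "A (Cod G s)" using A_ring Cod_objects s by blast
    have "h (\<phi> s \<otimes> \<phi> t) = monomial (s \<bullet>\<^bsub>G\<^esub> t)
        (\<one>\<^bsub>A (Cod G s)\<^esub> \<otimes>\<^bsub>A (Cod G s)\<^esub> \<alpha> s \<one>\<^bsub>A (Cod G t)\<^esub>)"
      using hm c s t \<phi> monomial_mult[OF s t one[OF s] one[OF t]] st by simp
    \<comment> \<open>The action is by unital maps, so the coefficient of the product is one
      again.\<close>
    also have "\<alpha> s \<one>\<^bsub>A (Cod G t)\<^esub> = \<one>\<^bsub>A (Cod G s)\<^esub>"
      using ring_hom_one[OF \<alpha>_ring_hom[OF s]] d by simp
    finally have "h (\<phi> s \<otimes> \<phi> t) = h (\<phi> (s \<bullet>\<^bsub>G\<^esub> t))"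
      using \<phi>(2)[OF Cmp_closed[OF st]] Cod_Cmp[OF st] by simp
    then show ?thesis
      using inj_onD[OF inj _ rng_m_closed[OF c[OF s] c[OF t]] c[OF Cmp_closed[OF st]]] by blast
  qed
  \<comment> \<open>\<open>graded_iso\<close> speaks only of sums, products and components, so
    unities have to be matched by hand: \<open>\<phi> e\<close> is shown to be a left identity on
    \<open>Rg e\<close> and is then multiplied with the unity of \<open>Rg e\<close>.\<close>
  have unity: "\<phi> e = unity_of R (Rg e)" if e: "e \<in> objects G" for e
  proof -
    note o = objects_simps[OF e]
    have *: "\<phi> e \<otimes> x = x" if x: "x \<in> Rg e" for x
    proof -
      interpret C: ring "A e" using A_ring e .
      let ?a = "h x e"
      have xc: "x \<in> carrier R" using x o component_subset by blast
      have "h x \<in> skew_component G A \<alpha> e" using x hR o by blast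
      then have a: "?a \<in> carrier (A e)" and m: "h x = monomial e ?a"
        using skew_component_eq_monomial[OF o(1), of "h x"] o by auto
      have "(e, e) \<in> composable G" "e \<bullet>\<^bsub>G\<^esub> e = e"
        using o Cmp_Dom[of e] by (auto simp: composable_def)
      then have "monomial e \<one>\<^bsub>A e\<^esub> \<otimes>\<^bsub>skew_ring G A \<alpha>\<^esub> monomial e ?a = monomial e ?a"
        using monomial_mult[OF o(1) o(1), of "\<one>\<^bsub>A e\<^esub>" ?a] a o \<alpha>_id[OF e a] by simp
      then have "h (\<phi> e \<otimes> x) = h x"
        using hm[OF c[OF o(1)] xc] \<phi>(2)[OF o(1)] m o by simp
      then show ?thesis using inj_onD[OF inj _ rng_m_closed[OF c[OF o(1)] xc] xc] by blast
    qed
    have "unity_of R (Rg e) \<in> Rg e" "\<phi> e \<otimes> unity_of R (Rg e) = \<phi> e"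
      using unity_of_component[OF e] \<phi>(1)[OF o(1)] by (auto simp: is_unity_of_def)
    then show ?thesis using * by simp
  qed
  \<comment> \<open>The object inverse of \<open>\<phi> s\<close> is
    \<open>\<phi> (ginv G s)\<close>.\<close>
  have oi: "object_invertible G R Rg s (\<phi> s)" if s: "s \<in> Mor G" for s
  proof -
    have "(s, ginv G s) \<in> composable G" "(ginv G s, s) \<in> composable G"
      using ginv_simps[OF s] s by (auto simp: composable_def)
    then show ?thesis
      unfolding object_invertible_def
      using \<phi>(1) s ginv_simps[OF s] mult unity Dom_objects Cod_objects by metis
  qed
  have U: "\<phi> s \<in> Mor (unit_groupoid G R Rg)" "gdeg G Rg (\<phi> s) = s" if "s \<in> Mor G" for s
    using oi[OF that] that gdeg_object_invertible by (auto simp: unit_groupoid_def)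
  have "(\<phi> s, \<phi> t) \<in> composable (unit_groupoid G R Rg)"
    "\<phi> (s \<bullet>\<^bsub>G\<^esub> t) = \<phi> s \<bullet>\<^bsub>unit_groupoid G R Rg\<^esub> \<phi> t" if "(s, t) \<in> composable G" for s t
    using that U mult[OF that]
    by (simp_all add: composable_unit_groupoid) (simp_all add: composable_def unit_groupoid_def)
  then have "\<phi> \<in> groupoid_hom G (unit_groupoid G R Rg)"
    using U by (auto simp: groupoid_hom_def)
  then show ?thesis using U unfolding splits_def by blast
qed

text \<open>A splitting is a right inverse of the degree map.\<close>

lemma splits_imp_gdeg_surj:
  assumes "splits (unit_groupoid G R Rg) G (gdeg G Rg)"
  shows "gdeg G Rg ` Mor (unit_groupoid G R Rg) = Mor G"
proof
  show "gdeg G Rg ` Mor (unit_groupoid G R Rg) \<subseteq> Mor G" using mem_unit_groupoid(1) by blast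
  obtain f where "f \<in> groupoid_hom G (unit_groupoid G R Rg)" "\<forall>s\<in>Mor G. gdeg G Rg (f s) = s"
    using assms unfolding splits_def by blast
  then show "Mor G \<subseteq> gdeg G Rg ` Mor (unit_groupoid G R Rg)"
    unfolding groupoid_hom_def by (force intro: rev_image_eqI)
qed

text \<open>Multiplicativity and degrees are read off from the splitting. Preservation of identities
  is not part of \<open>groupoid_hom\<close> and has to be derived.\<close>

lemma splits_graded_section:
  assumes "splits (unit_groupoid G R Rg) G (gdeg G Rg)"
  obtains \<phi> where "graded_section G R Rg \<phi>"
proof -
  obtain \<phi> where hom: "\<phi> \<in> groupoid_hom G (unit_groupoid G R Rg)"
    and deg: "\<And>s. s \<in> Mor G \<Longrightarrow> gdeg G Rg (\<phi> s) = s"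
    using assms unfolding splits_def by blast
  have mult: "\<phi> s \<otimes> \<phi> t = \<phi> (s \<bullet>\<^bsub>G\<^esub> t)" if "(s, t) \<in> composable G" for s t
    using hom that by (auto simp: groupoid_hom_def unit_groupoid_def)
  have oi: "object_invertible G R Rg s (\<phi> s)" if s: "s \<in> Mor G" for s
    using hom s deg[OF s] mem_unit_groupoid(2)[of "\<phi> s"] by (auto simp: groupoid_hom_def)
  then have mem: "\<phi> s \<in> Rg s" if "s \<in> Mor G" for s
    using that by (simp add: object_invertible_def)
  \<comment> \<open>The element \<open>\<phi> e\<close> is idempotent, and its object inverse
    \<open>y\<close> cancels one factor, which leaves the unity.\<close>
  have "\<phi> e = unity_of R (Rg e)" if e: "e \<in> objects G" for e
  proof -
    note o = objects_simps[OF e] ginv_object[OF e]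
    obtain y where y: "y \<in> Rg e" "y \<otimes> \<phi> e = unity_of R (Rg e)"
      using oi[OF o(1)] o by (auto simp: object_invertible_def)
    have "(e, e) \<in> composable G" "e \<bullet>\<^bsub>G\<^esub> e = e"
      using o Cmp_Dom[of e] by (auto simp: composable_def)
    then have "\<phi> e \<otimes> \<phi> e = \<phi> e" using mult by fastforce
    moreover have "y \<in> carrier R" "\<phi> e \<in> carrier R" using y mem o component_subset by auto
    ultimately have "y \<otimes> \<phi> e \<otimes> \<phi> e = y \<otimes> \<phi> e" by (simp add: rng_m_assoc)
    then show ?thesis using y unity_left[OF o(1) mem[OF o(1)]] o by simp
  qed
  then have "graded_section G R Rg \<phi>"
    using mem mult by unfold_locales auto
  then show thesis using that by blast
qed

end

text \<open>The existence of a skew ring is relative to a type for the coefficients. The equivalence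
  uses \<open>'r\<close>, since the constructed coefficient rings are components of
  \<open>R\<close>; the second conjunct gives the forward direction for coefficients from any type
  \<open>'a\<close>.\<close>

theorem proposition20:
  fixes G :: "'g gpd" and R :: "'r ring" and Rg :: "'g \<Rightarrow> 'r set"
  assumes "groupoid G"
    and "object_unital_rng G R Rg"
    and "\<forall>e \<in> objects G. unity_of R (Rg e) \<noteq> \<zero>\<^bsub>R\<^esub>"
  shows "(is_object_skew_groupoid_ring TYPE('r) G R Rg \<longleftrightarrow>
            gdeg G Rg ` Mor (unit_groupoid G R Rg) = Mor G \<and>
            splits (unit_groupoid G R Rg) G (gdeg G Rg)) \<and>
         (is_object_skew_groupoid_ring TYPE('a) G R Rg \<longrightarrow>
            gdeg G Rg ` Mor (unit_groupoid G R Rg) = Mor G \<and>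
            splits (unit_groupoid G R Rg) G (gdeg G Rg))"
proof -
  interpret object_unital_nonzero_rng G R Rg
    using assms by (simp add: object_unital_nonzero_rng_def object_unital_nonzero_rng_axioms_def)
  have "is_object_skew_groupoid_ring TYPE('r) G R Rg"
    if split: "splits (unit_groupoid G R Rg) G (gdeg G Rg)"
  proof -
    obtain \<phi> where "graded_section G R Rg \<phi>" using splits_graded_section[OF split] .
    then interpret graded_section G R Rg \<phi> .
    show ?thesis
      unfolding is_object_skew_groupoid_ring_def
      using object_skew_system_conjugation coefficients_graded_iso by blast
  qed
  then show ?thesis
    using skew_ring_splits[of "TYPE('r)"] skew_ring_splits[of "TYPE('a)"] splits_imp_gdeg_surj
    by blast
qed

end
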